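(* Let $q=1$, $p=n-2$, $n\ge4$ (so $M=\mathbb C\mathrm H^m$ with $n=2m$), and put $x=\sinh^2r$. For every point of $M\setminus\{o\}$ at distance $r$ from $o$ and every hyperplane $\Pi=\nu^\perp$ with unit normal decomposed as $\nu=\alpha N+v+w$, $\beta=|v|^2$, $\gamma=|w|^2$, $$\mathscr T_{n-2,1}=-\frac{\mathcal R_{n,x}(\beta,\gamma)}{(1+x)^2},$$ where $$\begin{aligned}\mathcal R_{n,x}(\beta,\gamma)={}&(x^2-x-1)\beta^2+(4x^2-x-2)\beta\gamma+(4x^2-1)\gamma^2\\&+\bigl((n-2)x^2+(2n-1)x+n\bigr)\beta+\bigl((2n-8)x^2+(3n-2)x+n\bigr)\gamma.\end{aligned}$$
   Context: $M=\mathbb C\mathrm H^m$ with metric $g$ of holomorphic sectional curvature $-4$, real dimension $n=2m$. Fix $o\in M$; $\mathbb S_o^{n-1}\subset T_oM$ is the unit sphere with round metric; $T_\theta\mathbb S_o^{n-1}=\mathcal H_\theta\oplus\mathcal V_\theta$ with $\mathcal V_\theta=\mathbb RJ\theta$ ($J$ the complex structure) and $\mathcal H_\theta$ its orthogonal complement, of dimension $p=n-2$. In polar coordinates $(r,\theta)$ about $o$, $g=dr^2+\sinh^2r\,g_{\mathcal H}+\sinh^2r\cosh^2r\,g_{\mathcal V}$, with $g_{\mathcal H},g_{\mathcal V}$ the restrictions of the round metric. The volume radius is $R(r)$ with $R^n=n\int_0^r\sinh^{n-1}s\cosh s\,ds$ (so $R=\sinh r$). For $\varphi\in C^1(\mathbb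 S_o^{n-1})$ let $F_{t,\varphi}(R,\theta)=(e^{t\varphi(\theta)}R,\theta)$ in coordinates $(R,\theta)$ on $M\setminus\{o\}$. For a unit vector $\nu$ at a point of $M\setminus\{o\}$ write $\nu=\alpha N+v+w$ with $N=\partial_r$ and $v,w$ in the subspaces tangent to the geodesic sphere corresponding to $\mathcal H_\theta,\mathcal V_\theta$. Put $J_\Pi(t,\varphi)=|\operatorname{cof}DF_{t,\varphi}\,\nu|$ with $\operatorname{cof}L=(\det L)L^{-T}$ (with respect to $g$ at source and target), i.e. the $(n-1)$-dimensional Jacobian of $DF_{t,\varphi}|_\Pi$. With $\varphi_j(\theta)=\langle\theta,e_j\rangle$ for an orthonormal basis $e_1,\dots,e_n$ of $T_oM$ and primes denoting $t$-derivatives, $$\mathscr T_{n-2,1}=\sum_{j=1}^nJ_\Pi''(0,\varphi_j)-nJ_\Pi'(0,1),$$ where $1$ denotes the constant function. *)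

theory Defs
  imports "HOL-Analysis.Analysis"
begin

section \<open>Complex hyperbolic space in the ball model\<close>

definition hprod :: "complex ^ 'm \<Rightarrow> complex ^ 'm \<Rightarrow> complex" where
  "hprod u v = (\<Sum>i\<in>UNIV. u $ i * cnj (v $ i))"

definition CH :: "(complex ^ 'm) set" where
  "CH = ball 0 1"

text \<open>
  All tangent spaces of the ball are identified with \<open>complex ^ 'm\<close>, and the complex structure is
  multiplication by \<open>\<i>\<close>. The Bergman metric is normalised to holomorphic sectional curvature -4:
  on the complex line through 0 it is \<open>|dz|\<^sup>2 / (1 - |z|\<^sup>2)\<^sup>2\<close>.
\<close>

definition bergman :: "complex ^ 'm \<Rightarrow> complex ^ 'm \<Rightarrow> complex ^ 'm \<Rightarrow> complex" where
  "bergman z u v =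
     (of_real (1 - (norm z)\<^sup>2) * hprod u v + hprod u z * hprod z v) / of_real ((1 - (norm z)\<^sup>2)\<^sup>2)"

definition chg :: "complex ^ 'm \<Rightarrow> complex ^ 'm \<Rightarrow> complex ^ 'm \<Rightarrow> real" where
  "chg z u v = Re (bergman z u v)"

definition unit_sphere :: "complex ^ 'm \<Rightarrow> (complex ^ 'm) set" where
  "unit_sphere b = {\<theta>. chg b \<theta> \<theta> = 1}"

definition vert_space :: "complex ^ 'm \<Rightarrow> (complex ^ 'm) set" where
  "vert_space \<theta> = span {\<i> *s \<theta>}"

definition hor_space :: "complex ^ 'm \<Rightarrow> complex ^ 'm \<Rightarrow> (complex ^ 'm) set" where
  "hor_space b \<theta> = {X. chg b X \<theta> = 0 \<and> (\<forall>Y\<in>vert_space \<theta>. chg b X Y = 0)}"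

section \<open>Polar coordinates about a base point\<close>

text \<open>
  \<open>polar b r \<theta>\<close> is the value at time \<open>r\<close> of the unit-speed geodesic issuing from \<open>b\<close> with initial
  velocity \<open>\<theta>\<close>. In the hyperboloid picture this geodesic is the class of \<open>cosh r B + sinh r \<Theta>\<close>, where
  \<open>B\<close> is the normalised lift \<open>(b, 1) / sqrt (1 - |b|\<^sup>2)\<close> of \<open>b\<close> and \<open>\<Theta>\<close> the lift of \<open>\<theta>\<close> orthogonal
  to \<open>B\<close>; for \<open>b = 0\<close> it is \<open>tanh r \<theta>\<close>. The lemmas \<open>polar_initial\<close>, \<open>bij_betw_polar\<close> and
  \<open>polar_metric\<close> below show that these are the polar coordinates in which the metric is
  \<open>dr\<^sup>2 + sinh\<^sup>2 r g\<^sub>H + sinh\<^sup>2 r cosh\<^sup>2 r g\<^sub>V\<close>; in particular \<open>r\<close> is the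
  distance from \<open>b\<close>.
\<close>

definition polar :: "complex ^ 'm \<Rightarrow> real \<Rightarrow> complex ^ 'm \<Rightarrow> complex ^ 'm" where
  "polar b r \<theta> =
     b + (of_real (tanh r) / (1 + of_real (tanh r) * hprod \<theta> b / of_real (1 - (norm b)\<^sup>2))) *s \<theta>"

definition polar_coords :: "complex ^ 'm \<Rightarrow> complex ^ 'm \<Rightarrow> real \<times> (complex ^ 'm)" where
  "polar_coords b = inv_into ({0<..} \<times> unit_sphere b) (\<lambda>(r, \<theta>). polar b r \<theta>)"

text \<open>
  The differential of the polar coordinate map, applied to a pair of a radial component and a
  vector tangent to the unit sphere.
\<close>

definition polar_diff ::
    "complex ^ 'm \<Rightarrow> real \<Rightarrow> complex ^ 'm \<Rightarrow> real \<times> (complex ^ 'm) \<Rightarrow> complex ^ 'm" where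
  "polar_diff b r \<theta> = frechet_derivative (\<lambda>(s, y). polar b s y) (at (r, \<theta>))"

section \<open>The volume radius and the maps \<open>F\<close>\<close>

definition vol_radius :: "nat \<Rightarrow> real \<Rightarrow> real" where
  "vol_radius n r = root n (real n * integral {0..r} (\<lambda>s. sinh s ^ (n - 1) * cosh s))"

definition radial_map ::
    "complex ^ 'm \<Rightarrow> real \<Rightarrow> (complex ^ 'm \<Rightarrow> real) \<Rightarrow> complex ^ 'm \<Rightarrow> complex ^ 'm" where
  "radial_map b t \<phi> z =
     (let n = 2 * CARD('m); (r, \<theta>) = polar_coords b z;
          r' = inv_into {0<..} (vol_radius n) (exp (t * \<phi> \<theta>) * vol_radius n r)
      in polar b r' \<theta>)"

section \<open>Cofactor of a linear map between tangent spaces\<close>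

definition real_frame :: "'m + 'm \<Rightarrow> complex ^ 'm" where
  "real_frame k = (case k of Inl i \<Rightarrow> axis i 1 | Inr i \<Rightarrow> axis i \<i>)"

definition gram_det :: "complex ^ 'm \<Rightarrow> real" where
  "gram_det z = det (\<chi> i j. chg z (real_frame i) (real_frame j) :: real ^ ('m + 'm) ^ ('m + 'm))"

text \<open>
  The determinant of \<open>L\<close>, as a map from the tangent space at \<open>z\<close> to that at \<open>w\<close>, with respect to
  oriented orthonormal bases for the metric at the two points.
\<close>

definition metric_det ::
    "complex ^ 'm \<Rightarrow> complex ^ 'm \<Rightarrow> (complex ^ 'm \<Rightarrow> complex ^ 'm) \<Rightarrow> real" where
  "metric_det z w L =
     det (\<chi> i j. real_frame i \<bullet> L (real_frame j) :: real ^ ('m + 'm) ^ ('m + 'm))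
       * sqrt (gram_det w) / sqrt (gram_det z)"

definition metric_adj ::
    "complex ^ 'm \<Rightarrow> complex ^ 'm \<Rightarrow> (complex ^ 'm \<Rightarrow> complex ^ 'm) \<Rightarrow> complex ^ 'm \<Rightarrow> complex ^ 'm" where
  "metric_adj z w L v = (THE u. \<forall>x. chg z x u = chg w (L x) v)"

definition metric_cof ::
    "complex ^ 'm \<Rightarrow> complex ^ 'm \<Rightarrow> (complex ^ 'm \<Rightarrow> complex ^ 'm) \<Rightarrow> complex ^ 'm \<Rightarrow> complex ^ 'm" where
  "metric_cof z w L v = metric_det z w L *\<^sub>R inv (metric_adj z w L) v"

definition J_Pi ::
    "complex ^ 'm \<Rightarrow> complex ^ 'm \<Rightarrow> complex ^ 'm \<Rightarrow> real \<Rightarrow> (complex ^ 'm \<Rightarrow> real) \<Rightarrow> real" where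
  "J_Pi b z \<nu> t \<phi> =
     (let w = radial_map b t \<phi> z;
          L = frechet_derivative (radial_map b t \<phi>) (at z);
          c = metric_cof z w L \<nu>
      in sqrt (chg w c c))"

definition trace_form ::
    "complex ^ 'm \<Rightarrow> ('m + 'm \<Rightarrow> complex ^ 'm) \<Rightarrow> complex ^ 'm \<Rightarrow> complex ^ 'm \<Rightarrow> real" where
  "trace_form b e z \<nu> =
     (\<Sum>j\<in>UNIV. deriv (deriv (\<lambda>t. J_Pi b z \<nu> t (\<lambda>\<theta>. chg b \<theta> (e j)))) 0)
       - real (2 * CARD('m)) * deriv (\<lambda>t. J_Pi b z \<nu> t (\<lambda>_. 1)) 0"

section \<open>Validation of the polar coordinates\<close>

lemma hprod_simps:
  "hprod (u + u') v = hprod u v + hprod u' v" "hprod u (v + v') = hprod u v + hprod u v'"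
  "hprod (u - u') v = hprod u v - hprod u' v" "hprod u (v - v') = hprod u v - hprod u v'"
  "hprod (c *s u) v = c * hprod u v" "hprod u (c *s v) = cnj c * hprod u v"
  "hprod (x *\<^sub>R u) v = of_real x * hprod u v" "hprod u (x *\<^sub>R v) = of_real x * hprod u v"
  unfolding hprod_def
  by (simp_all add: algebra_simps sum.distrib sum_subtractf sum_distrib_left,
      simp_all add: scaleR_conv_of_real[where 'a = complex] mult_ac)

lemma cnj_hprod: "cnj (hprod u v) = hprod v u"
  by (simp add: hprod_def mult.commute)

lemma hprod_self: "hprod u u = of_real ((norm u)\<^sup>2)"
  by (simp add: hprod_def norm_vec_def L2_set_def real_sqrt_pow2 sum_nonneg
      complex_norm_square[symmetric] flip: of_real_power)

lemma norm_hprod_le: "cmod (hprod u v) \<le> norm u * norm v"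
proof -
  have "cmod (hprod u v) \<le> (\<Sum>i\<in>UNIV. cmod (u $ i) * cmod (v $ i))"
    unfolding hprod_def by (rule order_trans[OF norm_sum]) (simp add: norm_mult)
  also have "\<dots> \<le> norm u * norm v"
    unfolding norm_vec_def using L2_set_mult_ineq[of "\<lambda>i. norm (u $ i)" "\<lambda>i. norm (v $ i)" UNIV]
    by simp
  finally show ?thesis .
qed

lemma CH_iff: "b \<in> CH \<longleftrightarrow> 0 < 1 - (norm b)\<^sup>2"
  using abs_square_less_1[of "norm b"] by (simp add: CH_def)

lemma bergman_simps:
  "bergman b (u + u') v = bergman b u v + bergman b u' v"
  "bergman b u (v + v') = bergman b u v + bergman b u v'"
  "bergman b (c *s u) v = c * bergman b u v" "bergman b u (c *s v) = cnj c * bergman b u v"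
  "bergman b (x *\<^sub>R u) v = of_real x * bergman b u v"
  "bergman b u (x *\<^sub>R v) = of_real x * bergman b u v"
  unfolding bergman_def by (simp_all add: hprod_simps add_divide_distrib[symmetric] algebra_simps)

lemma cnj_bergman: "cnj (bergman b u v) = bergman b v u"
  by (simp add: bergman_def cnj_hprod mult.commute)

lemma bergman_self:
  assumes "b \<in> CH"
  shows "bergman b y y = of_real (chg b y y)"
    and "chg b y y = (norm y)\<^sup>2 / (1 - (norm b)\<^sup>2) + (cmod (hprod y b))\<^sup>2 / (1 - (norm b)\<^sup>2)\<^sup>2"
proof -
  have "hprod y b * hprod b y = of_real ((cmod (hprod y b))\<^sup>2)"
    by (metis cnj_hprod complex_norm_square)
  then have *: "bergman b y y =
      of_real (((1 - (norm b)\<^sup>2) * (norm y)\<^sup>2 + (cmod (hprod y b))\<^sup>2) / (1 - (norm b)\<^sup>2)\<^sup>2)"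
    by (simp add: bergman_def hprod_self)
  then show "bergman b y y = of_real (chg b y y)"
    unfolding chg_def by (simp only: Re_complex_of_real)
  have "1 - (norm b)\<^sup>2 \<noteq> 0" using assms CH_iff by force
  then have "((1 - (norm b)\<^sup>2) * q + p) / (1 - (norm b)\<^sup>2)\<^sup>2 = q / (1 - (norm b)\<^sup>2) + p / (1 - (norm b)\<^sup>2)\<^sup>2"
    for q p by (simp add: add_divide_distrib power2_eq_square)
  with * show "chg b y y = (norm y)\<^sup>2 / (1 - (norm b)\<^sup>2) + (cmod (hprod y b))\<^sup>2 / (1 - (norm b)\<^sup>2)\<^sup>2"
    unfolding chg_def by (simp only: Re_complex_of_real)
qed

lemma chg_pos:
  assumes "b \<in> CH" "y \<noteq> 0"
  shows "0 < chg b y y"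
proof -
  have "0 < (norm y)\<^sup>2 / (1 - (norm b)\<^sup>2)" using assms by (simp add: CH_iff)
  moreover have "0 \<le> (cmod (hprod y b))\<^sup>2 / (1 - (norm b)\<^sup>2)\<^sup>2" by simp
  ultimately show ?thesis using bergman_self(2)[OF assms(1), of y] by linarith
qed

lemma bounded_bilinear_vector_smult:
  "bounded_bilinear (\<lambda>c (x :: complex ^ 'm). c *s x)"
proof (rule bilinear_conv_bounded_bilinear[THEN iffD1], unfold bilinear_def, intro conjI allI linearI)
qed (simp_all add: vec_eq_iff algebra_simps)

lemma bounded_linear_hprod: "bounded_linear (\<lambda>u :: complex ^ 'm. hprod u v)"
proof (rule linear_conv_bounded_linear[THEN iffD1], rule linearI)
qed (simp_all add: hprod_simps scaleR_conv_of_real[where 'a = complex])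

text \<open>
  The geodesics from \<open>b\<close> are the images of rays under the following projective map, with
  denominator \<open>proj_den\<close> and differential \<open>proj_diff\<close>.
\<close>

definition proj_den :: "complex ^ 'm \<Rightarrow> complex ^ 'm \<Rightarrow> complex" where
  "proj_den b y = 1 + hprod y b / of_real (1 - (norm b)\<^sup>2)"

definition proj_map :: "complex ^ 'm \<Rightarrow> complex ^ 'm \<Rightarrow> complex ^ 'm" where
  "proj_map b y = b + (1 / proj_den b y) *s y"

definition proj_diff :: "complex ^ 'm \<Rightarrow> complex ^ 'm \<Rightarrow> complex ^ 'm \<Rightarrow> complex ^ 'm" where
  "proj_diff b y a = (1 / proj_den b y) *s a
     - (hprod a b / of_real (1 - (norm b)\<^sup>2) / (proj_den b y)\<^sup>2) *s y"

lemma polar_eq_proj_map: "polar b r \<theta> = proj_map b (tanh r *\<^sub>R \<theta>)"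
proof -
  have "(tanh r *\<^sub>R \<theta>) = of_real (tanh r) *s \<theta>"
    by (simp add: vec_eq_iff scaleR_conv_of_real[where 'a = complex])
  then show ?thesis
    by (simp add: polar_def proj_map_def proj_den_def hprod_simps vec_eq_iff)
qed

lemma proj_den_nonzero:
  assumes b: "b \<in> CH" and y: "chg b y y < 1"
  shows "proj_den b y \<noteq> 0"
proof
  assume "proj_den b y = 0"
  then have "hprod y b / of_real (1 - (norm b)\<^sup>2) = -1"
    by (metis add_eq_0_iff proj_den_def)
  then have "cmod (hprod y b / of_real (1 - (norm b)\<^sup>2)) = 1" by simp
  then have "(cmod (hprod y b))\<^sup>2 / (1 - (norm b)\<^sup>2)\<^sup>2 = 1"
    by (metis norm_divide norm_of_real power2_abs power_divide power_one)
  moreover have "0 \<le> (norm y)\<^sup>2 / (1 - (norm b)\<^sup>2)" using b by (simp add: CH_iff)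
  ultimately show False using y bergman_self(2)[OF b, of y] by linarith
qed

lemma proj_map_has_derivative:
  assumes D0: "proj_den b y \<noteq> 0"
  shows "(proj_map b has_derivative proj_diff b y) (at y)"
proof -
  have "((\<lambda>y. proj_den b y) has_derivative (\<lambda>a. hprod a b / of_real (1 - (norm b)\<^sup>2))) (at y)"
    unfolding proj_den_def
    by (rule has_derivative_eq_rhs, (rule derivative_intros bounded_linear.has_derivative[OF bounded_linear_divide]
          bounded_linear_imp_has_derivative bounded_linear_hprod)+) simp
  then have "((\<lambda>y. inverse (proj_den b y)) has_derivative
      (\<lambda>a. - (inverse (proj_den b y) * (hprod a b / of_real (1 - (norm b)\<^sup>2)) * inverse (proj_den b y)))) (at y)"
    by (rule Deriv.has_derivative_inverse[where f = "proj_den b", OF D0])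
  from bounded_bilinear.FDERIV[OF bounded_bilinear_vector_smult this has_derivative_ident]
  have "((\<lambda>y. b + inverse (proj_den b y) *s y) has_derivative (\<lambda>a. inverse (proj_den b y) *s a +
      (- (inverse (proj_den b y) * (hprod a b / of_real (1 - (norm b)\<^sup>2)) * inverse (proj_den b y))) *s y)) (at y)"
    by (rule has_derivative_add[OF has_derivative_const, THEN has_derivative_eq_rhs]) simp
  then show ?thesis
    by (simp add: proj_map_def[abs_def] proj_diff_def[abs_def] divide_inverse power2_eq_square
        vec_eq_iff fun_eq_iff algebra_simps)
qed

lemma proj_map_facts:
  fixes b y a c :: "complex ^ 'm"
  assumes b: "b \<in> CH" and D0: "proj_den b y \<noteq> 0"
  shows norm_proj_map: "of_real (1 - (norm (proj_map b y))\<^sup>2) =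
      of_real (1 - (norm b)\<^sup>2) * (1 - bergman b y y) / (proj_den b y * cnj (proj_den b y))"
    and bergman_proj_map: "bergman b y y \<noteq> 1 \<Longrightarrow>
      bergman (proj_map b y) (proj_diff b y a) (proj_diff b y c) =
      ((1 - bergman b y y) * bergman b a c + bergman b a y * bergman b y c) / (1 - bergman b y y)\<^sup>2"
proof -
  define s where "s = complex_of_real (1 - (norm b)\<^sup>2)"
  define D where "D = proj_den b y"
  define D' where "D' = cnj (proj_den b y)"
  define k where "k = hprod y b / s"
  define k' where "k' = hprod b y / s"
  define ka where "ka = hprod a b / s"
  define kc where "kc = hprod b c / s"
  define A where "A = hprod a c"
  define P where "P = hprod a y"
  define Q where "Q = hprod y c"
  define Y where "Y = hprod y y"
  define W where "W = 1 - bergman b y y"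
  have "1 - (norm b)\<^sup>2 \<noteq> 0" using b CH_iff by force
  then have s0: "s \<noteq> 0" unfolding s_def of_real_eq_0_iff .
  have cs: "cnj s = s" by (simp add: s_def)
  have D: "D = 1 + k" "D' = 1 + k'"
    by (simp_all add: D_def D'_def k_def k'_def proj_den_def s_def cnj_hprod)
  have h: "hprod y b = s * k" "hprod b y = s * k'" "hprod a b = s * ka" "hprod b c = s * kc"
    using s0 by (simp_all add: k_def k'_def ka_def kc_def)
  have bb: "hprod b b = 1 - s" by (simp add: hprod_self s_def)
  have nz: "D \<noteq> 0" "D' \<noteq> 0" using D0 by (auto simp: D_def D'_def)
  have berg: "bergman b u v = hprod u v / s + (hprod u b / s) * (hprod b v / s)" for u v
    using s0 unfolding bergman_def of_real_power s_def[symmetric]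
    by (simp add: power2_eq_square field_simps)
  have H: "s * bergman b a c = A + s * ka * kc" "s * bergman b a y = P + s * ka * k'"
    "s * bergman b y c = Q + s * k * kc" "s * W = s - Y - s * k * k'"
    using s0 unfolding W_def berg h A_def P_def Q_def Y_def by (simp_all add: field_simps)
  have pm: "proj_map b y = b + (1 / D) *s y" by (simp add: proj_map_def D_def)
  have pd: "proj_diff b y u = (1 / D) *s u - (hprod u b / s / D\<^sup>2) *s y" for u
    by (simp add: proj_diff_def D_def s_def)
  have cD: "cnj D = D'" by (simp add: D_def D'_def)
  have hh: "hprod (proj_map b y) (proj_map b y) = 1 - s + s * k' / D' + s * k / D + Y / (D * D')"
    unfolding pm by (simp add: hprod_simps bb h cD Y_def field_simps nz)
  have "1 - hprod (proj_map b y) (proj_map b y) = s * W / (D * D')"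
    unfolding hh H using nz by (simp add: field_simps) (simp add: D algebra_simps)
  then have nW: "of_real (1 - (norm (proj_map b y))\<^sup>2) = s * W / (D * D')"
    by (simp add: hprod_self)
  then show "of_real (1 - (norm (proj_map b y))\<^sup>2) =
      of_real (1 - (norm b)\<^sup>2) * (1 - bergman b y y) / (proj_den b y * cnj (proj_den b y))"
    by (simp add: s_def W_def D_def D'_def)
  assume "bergman b y y \<noteq> 1"
  then have W0: "W \<noteq> 0" by (simp add: W_def)
  have kc: "cnj (hprod c b / s) = kc" by (simp add: kc_def cnj_hprod cs)
  have kc': "cnj (hprod c b) = s * kc" by (simp add: h cnj_hprod)
  have N1: "hprod (proj_diff b y a) (proj_diff b y c) =
      (A * D * D' - P * kc * D - ka * Q * D' + ka * kc * Y) / (D\<^sup>2 * D'\<^sup>2)"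
    unfolding pd using nz s0
    by (simp add: hprod_simps h kc' cs cD A_def P_def Q_def Y_def)
       (simp add: field_simps power2_eq_square)
  have "hprod (proj_diff b y a) (proj_map b y) =
      (s * ka * D' * (D - k) + P * D - ka * Y) / (D\<^sup>2 * D')"
    unfolding pm pd using nz s0
    by (simp add: hprod_simps h cs cD P_def Y_def) (simp add: field_simps power2_eq_square)
  then have N2: "hprod (proj_diff b y a) (proj_map b y) =
      (s * ka * D' + P * D - ka * Y) / (D\<^sup>2 * D')" by (simp add: D)
  have "hprod (proj_map b y) (proj_diff b y c) =
      (s * kc * D * (D' - k') + Q * D' - kc * Y) / (D * D'\<^sup>2)"
    unfolding pm pd using nz s0
    by (simp add: hprod_simps h kc' cs cD Q_def Y_def) (simp add: field_simps power2_eq_square)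
  then have N3: "hprod (proj_map b y) (proj_diff b y c) =
      (s * kc * D + Q * D' - kc * Y) / (D * D'\<^sup>2)" by (simp add: D)
  have "s * W * (A * D * D' - P * kc * D - ka * Q * D' + ka * kc * Y)
        + (s * ka * D' + P * D - ka * Y) * (s * kc * D + Q * D' - kc * Y)
      = D * D' * (s * W * (s * bergman b a c) + (s * bergman b a y) * (s * bergman b y c))"
    unfolding H D by (simp add: algebra_simps)
  then have *: "s * W * (A * D * D' - P * kc * D - ka * Q * D' + ka * kc * Y)
        + (s * ka * D' + P * D - ka * Y) * (s * kc * D + Q * D' - kc * Y)
      = D * D' * s\<^sup>2 * (W * bergman b a c + bergman b a y * bergman b y c)"
    by (simp add: algebra_simps power2_eq_square)
  have frac: "(s * W / (D * D') * (U / (D\<^sup>2 * D'\<^sup>2)) + V / (D\<^sup>2 * D') * (R / (D * D'\<^sup>2))) / Z =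
      (s * W * U + V * R) / (D ^ 3 * D' ^ 3) / Z" for U V R Z
    by (simp add: add_divide_distrib power2_eq_square power3_eq_cube mult_ac)
  have "bergman (proj_map b y) (proj_diff b y a) (proj_diff b y c) =
      (s * W / (D * D') * ((A * D * D' - P * kc * D - ka * Q * D' + ka * kc * Y) / (D\<^sup>2 * D'\<^sup>2))
        + (s * ka * D' + P * D - ka * Y) / (D\<^sup>2 * D') * ((s * kc * D + Q * D' - kc * Y) / (D * D'\<^sup>2)))
      / (s * W / (D * D'))\<^sup>2"
    unfolding bergman_def of_real_power nW N1 N2 N3 ..
  also have "\<dots> = (s * W * (A * D * D' - P * kc * D - ka * Q * D' + ka * kc * Y)
        + (s * ka * D' + P * D - ka * Y) * (s * kc * D + Q * D' - kc * Y))
      / (D ^ 3 * D' ^ 3) / (s * W / (D * D'))\<^sup>2"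
    by (rule frac)
  also have "\<dots> = (W * bergman b a c + bergman b a y * bergman b y c) / W\<^sup>2"
    unfolding * using nz s0 W0 by (simp add: divide_simps power2_eq_square power3_eq_cube)
  finally show "bergman (proj_map b y) (proj_diff b y a) (proj_diff b y c) =
      ((1 - bergman b y y) * bergman b a c + bergman b a y * bergman b y c) / (1 - bergman b y y)\<^sup>2"
    by (simp add: W_def)
qed

lemma bij_betw_proj_map:
  fixes b :: "complex ^ 'm"
  assumes b: "b \<in> CH"
  shows "bij_betw (proj_map b) {y. chg b y y < 1} CH"
proof (rule bij_betw_imageI)
  have s0: "1 - (norm b)\<^sup>2 > 0" using b by (simp add: CH_iff)
  define s where "s = complex_of_real (1 - (norm b)\<^sup>2)"
  have s: "s \<noteq> 0" unfolding s_def using s0 by (metis less_irrefl of_real_eq_0_iff)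
  have norm: "1 - (norm (proj_map b y))\<^sup>2 =
      (1 - (norm b)\<^sup>2) * (1 - chg b y y) / (cmod (proj_den b y))\<^sup>2" if "proj_den b y \<noteq> 0" for y
  proof -
    have "of_real (1 - (norm (proj_map b y))\<^sup>2) =
        complex_of_real ((1 - (norm b)\<^sup>2) * (1 - chg b y y) / (cmod (proj_den b y))\<^sup>2)"
      using norm_proj_map[OF b that] complex_norm_square[of "proj_den b y"]
      unfolding bergman_self(1)[OF b] by simp
    then show ?thesis by (simp only: of_real_eq_iff)
  qed
  show "inj_on (proj_map b) {y. chg b y y < 1}"
  proof (rule inj_onI, clarify)
    fix y y' assume lt: "chg b y y < 1" "chg b y' y' < 1" and eq: "proj_map b y = proj_map b y'"
    have rec: "y = proj_den b y *s (proj_map b y - b)"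
      "proj_den b y * (1 - hprod (proj_map b y - b) b / s) = 1" if "chg b y y < 1" for y
    proof -
      note nz = proj_den_nonzero[OF b that]
      then show "y = proj_den b y *s (proj_map b y - b)" by (simp add: proj_map_def)
      have "proj_den b y * (hprod (proj_map b y - b) b / s) = hprod y b / s"
        using nz by (simp add: proj_map_def hprod_simps)
      then have "proj_den b y * (1 - hprod (proj_map b y - b) b / s) = proj_den b y - hprod y b / s"
        by (simp only: right_diff_distrib mult_1_right)
      then show "proj_den b y * (1 - hprod (proj_map b y - b) b / s) = 1"
        by (simp add: proj_den_def s_def)
    qed
    have "proj_den b y = proj_den b y'"
      using rec(2)[OF lt(1)] rec(2)[OF lt(2)] unfolding eq by (metis mult_cancel_right mult_zero_right zero_neq_one)
    then show "y = y'" using rec(1)[OF lt(1)] rec(1)[OF lt(2)] eq by simp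
  qed
  show "proj_map b ` {y. chg b y y < 1} = CH"
  proof (intro equalityI subsetI)
    fix z assume "z \<in> proj_map b ` {y. chg b y y < 1}"
    then obtain y where y: "chg b y y < 1" "z = proj_map b y" by auto
    note nz = proj_den_nonzero[OF b y(1)]
    have "0 < (1 - (norm b)\<^sup>2) * (1 - chg b y y) / (cmod (proj_den b y))\<^sup>2"
      using s0 y(1) nz by simp
    then show "z \<in> CH" unfolding CH_iff y(2) norm[OF nz] .
  next
    fix z :: "complex ^ 'm" assume z: "z \<in> CH"
    define q where "q = hprod (z - b) b / s"
    have "cmod (hprod z b) < 1"
    proof -
      have "norm z < 1" "norm b < 1" using z b by (simp_all add: CH_def)
      then have "norm z * norm b < 1" by (metis mult_strict_mono' mult_1 norm_ge_zero)
      with norm_hprod_le[of z b] show ?thesis by linarith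
    qed
    then have "hprod z b \<noteq> 1" by force
    have eq: "hprod (z - b) b = hprod z b - 1 + s" by (simp add: hprod_simps hprod_self s_def)
    have "1 - q = (1 - hprod z b) / s"
      unfolding q_def eq using s by (simp add: field_simps)
    then have q: "1 - q \<noteq> 0" using s \<open>hprod z b \<noteq> 1\<close> by simp
    define y where "y = (1 / (1 - q)) *s (z - b)"
    have "hprod y b / s = q / (1 - q)"
      unfolding y_def hprod_simps(5) q_def by simp
    then have "proj_den b y = 1 + q / (1 - q)"
      unfolding proj_den_def s_def[symmetric] by simp
    then have D: "proj_den b y = 1 / (1 - q)" using q by (simp add: field_simps)
    have zy: "z = proj_map b y" unfolding proj_map_def D using q by (simp add: y_def)
    have nz: "proj_den b y \<noteq> 0" using D q by simp
    have "0 < 1 - (norm (proj_map b y))\<^sup>2" using z zy by (simp add: CH_iff)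
    then have "chg b y y < 1"
      unfolding norm[OF nz] using s0 nz by (simp add: zero_less_divide_iff zero_less_mult_iff)
    with zy show "z \<in> proj_map b ` {y. chg b y y < 1}" by blast
  qed
qed

lemma chg_scaleR: "chg b (x *\<^sub>R u) (x *\<^sub>R u) = x\<^sup>2 * chg b u u"
  by (simp add: chg_def bergman_simps power2_eq_square)

lemma proj_map_0: "proj_map b 0 = b"
  by (simp add: proj_map_def vec_eq_iff)

lemma tanh_artanh_real:
  assumes "0 < q" "q < (1 :: real)"
  shows "tanh (artanh q) = q"
proof -
  have "exp (- (2 * artanh q)) = (1 - q) / (1 + q)"
    using assms by (simp add: artanh_def exp_minus)
  then have "tanh (artanh q) = (1 - (1 - q) / (1 + q)) / (1 + (1 - q) / (1 + q))"
    by (simp add: tanh_real_altdef)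
  also have "\<dots> = q" using assms by (simp add: divide_simps)
  finally show ?thesis .
qed

lemma bij_betw_polar:
  fixes b :: "complex ^ 'm"
  assumes b: "b \<in> CH"
  shows "bij_betw (\<lambda>(r, \<theta>). polar b r \<theta>) ({0<..} \<times> unit_sphere b) (CH - {b})"
proof -
  have "bij_betw (proj_map b) ({y. chg b y y < 1} - {0}) (CH - {proj_map b 0})"
    by (rule bij_betw_DiffI[OF bij_betw_proj_map[OF b]]) (auto simp: b proj_map_0 chg_def bergman_def hprod_def)
  then have P: "bij_betw (proj_map b) ({y. chg b y y < 1} - {0}) (CH - {b})" by (simp add: proj_map_0)
  have "bij_betw (\<lambda>(r, \<theta>). tanh r *\<^sub>R \<theta>) ({0<..} \<times> unit_sphere b) ({y. chg b y y < 1} - {0})"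
  proof (rule bij_betw_byWitness[where f' =
        "\<lambda>y. (artanh (sqrt (chg b y y)), (1 / sqrt (chg b y y)) *\<^sub>R y)"])
    show "\<forall>a\<in>{0<..} \<times> unit_sphere b. (\<lambda>y. (artanh (sqrt (chg b y y)), (1 / sqrt (chg b y y)) *\<^sub>R y))
        ((\<lambda>(r, \<theta>). tanh r *\<^sub>R \<theta>) a) = a"
      by (auto simp: unit_sphere_def chg_scaleR artanh_tanh_real)
    show "\<forall>y\<in>{y. chg b y y < 1} - {0}. (\<lambda>(r, \<theta>). tanh r *\<^sub>R \<theta>)
        (artanh (sqrt (chg b y y)), (1 / sqrt (chg b y y)) *\<^sub>R y) = y"
    proof
      fix y assume y: "y \<in> {y. chg b y y < 1} - {0}"
      with chg_pos[OF b, of y] have "0 < sqrt (chg b y y)" "sqrt (chg b y y) < 1" by auto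
      then have "tanh (artanh (sqrt (chg b y y))) = sqrt (chg b y y)" by (simp add: tanh_artanh_real)
      with \<open>0 < sqrt (chg b y y)\<close> show "(\<lambda>(r, \<theta>). tanh r *\<^sub>R \<theta>)
        (artanh (sqrt (chg b y y)), (1 / sqrt (chg b y y)) *\<^sub>R y) = y" by simp
    qed
    show "(\<lambda>(r, \<theta>). tanh r *\<^sub>R \<theta>) ` ({0<..} \<times> unit_sphere b) \<subseteq> {y. chg b y y < 1} - {0}"
    proof clarify
      fix r :: real and \<theta> :: "complex ^ 'm" assume "0 < r" "\<theta> \<in> unit_sphere b"
      then have "chg b \<theta> \<theta> = 1" "\<theta> \<noteq> 0" by (auto simp: unit_sphere_def chg_def bergman_def hprod_def)
      moreover have "(tanh r)\<^sup>2 < 1"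
        using tanh_real_lt_1[of r] tanh_real_gt_neg1[of r] by (simp add: abs_square_less_1 abs_less_iff)
      ultimately show "tanh r *\<^sub>R \<theta> \<in> {y. chg b y y < 1} - {0}"
        using \<open>0 < r\<close> by (simp add: chg_scaleR)
    qed
    show "(\<lambda>y. (artanh (sqrt (chg b y y)), (1 / sqrt (chg b y y)) *\<^sub>R y)) ` ({y. chg b y y < 1} - {0})
        \<subseteq> {0<..} \<times> unit_sphere b"
    proof (rule image_subsetI)
      fix y assume "y \<in> {y. chg b y y < 1} - {0}"
      then have y: "chg b y y < 1" "y \<noteq> 0" by auto
      from chg_pos[OF b y(2)] have pos: "0 < chg b y y" .
      have "sqrt (chg b y y) < 1" using y by simp
      with pos have "1 < (1 + sqrt (chg b y y)) / (1 - sqrt (chg b y y))"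
        by (simp add: less_divide_eq)
      then have "0 < artanh (sqrt (chg b y y))" by (simp add: artanh_def)
      with pos show "(artanh (sqrt (chg b y y)), (1 / sqrt (chg b y y)) *\<^sub>R y) \<in> {0<..} \<times> unit_sphere b"
        by (simp add: unit_sphere_def chg_scaleR power_divide)
    qed
  qed
  from bij_betw_trans[OF this P] show ?thesis
    by (simp add: polar_eq_proj_map comp_def case_prod_unfold)
qed

lemma polar_has_derivative:
  assumes b: "b \<in> CH" and \<theta>: "\<theta> \<in> unit_sphere b"
  shows "((\<lambda>(s, y). polar b s y) has_derivative
    (\<lambda>(a, X). proj_diff b (tanh r *\<^sub>R \<theta>) ((a * (1 - (tanh r)\<^sup>2)) *\<^sub>R \<theta> + tanh r *\<^sub>R X))) (at (r, \<theta>))"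
    and tanh_square_less_1: "(tanh r)\<^sup>2 < 1"
proof -
  show lt: "(tanh r)\<^sup>2 < 1"
    using tanh_real_lt_1[of r] tanh_real_gt_neg1[of r] by (simp add: abs_square_less_1 abs_less_iff)
  then have "chg b (tanh r *\<^sub>R \<theta>) (tanh r *\<^sub>R \<theta>) < 1"
    using \<theta> by (simp add: unit_sphere_def chg_scaleR)
  then have D0: "proj_den b (tanh r *\<^sub>R \<theta>) \<noteq> 0" by (rule proj_den_nonzero[OF b])
  have "((\<lambda>p. tanh (fst p) *\<^sub>R snd p) has_derivative
      (\<lambda>p. tanh r *\<^sub>R snd p + (fst p * (1 - (tanh r)\<^sup>2)) *\<^sub>R \<theta>)) (at (r, \<theta>))"
  proof -
    have "((\<lambda>p. tanh (fst p)) has_derivative (\<lambda>p. fst p * (1 - (tanh r)\<^sup>2))) (at (r, \<theta>))"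
      using DERIV_compose_FDERIV[OF has_field_derivative_tanh[OF cosh_real_nonzero, OF DERIV_ident]
          has_derivative_fst[OF has_derivative_ident], of "(r, \<theta>)" UNIV] by (simp add: mult.commute)
    from has_derivative_scaleR[OF this has_derivative_snd[OF has_derivative_ident]]
    show ?thesis by simp
  qed
  from has_derivative_compose[OF this, of "proj_map b", simplified, OF proj_map_has_derivative[OF D0]]
  show "((\<lambda>(s, y). polar b s y) has_derivative
    (\<lambda>(a, X). proj_diff b (tanh r *\<^sub>R \<theta>) ((a * (1 - (tanh r)\<^sup>2)) *\<^sub>R \<theta> + tanh r *\<^sub>R X))) (at (r, \<theta>))"
    by (simp add: polar_eq_proj_map case_prod_unfold add.commute)
qed

lemma polar_initial:
  assumes b: "b \<in> CH" and \<theta>: "\<theta> \<in> unit_sphere b"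
  shows "polar b 0 \<theta> = b" and "((\<lambda>s. polar b s \<theta>) has_vector_derivative \<theta>) (at 0)"
proof -
  show "polar b 0 \<theta> = b" by (simp add: polar_eq_proj_map proj_map_0)
  have "proj_diff b 0 \<theta> = \<theta>" by (simp add: proj_diff_def proj_den_def hprod_def vec_eq_iff)
  moreover have "proj_diff b 0 (a *\<^sub>R \<theta>) = a *\<^sub>R proj_diff b 0 \<theta>" for a
    by (simp add: proj_diff_def proj_den_def hprod_def vec_eq_iff)
  ultimately have "((\<lambda>(s, y). polar b s y) has_derivative (\<lambda>(a, X). a *\<^sub>R \<theta>)) (at (0, \<theta>))"
    using polar_has_derivative(1)[OF b \<theta>, of 0] by simp
  moreover have "((\<lambda>s. (s, \<theta>)) has_derivative (\<lambda>a. (a, 0))) (at (0 :: real))"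
    by (rule has_derivative_Pair[OF has_derivative_ident has_derivative_const])
  ultimately have "((\<lambda>s. polar b s \<theta>) has_derivative (\<lambda>a. a *\<^sub>R \<theta>)) (at 0)"
    using has_derivative_compose[of "\<lambda>s. (s, \<theta>)" "\<lambda>a. (a, 0)" 0 UNIV
        "\<lambda>(s, y). polar b s y" "\<lambda>(a, X). a *\<^sub>R \<theta>"] by simp
  then show "((\<lambda>s. polar b s \<theta>) has_vector_derivative \<theta>) (at 0)"
    by (simp add: has_vector_derivative_def)
qed

lemma polar_metric:
  assumes b: "b \<in> CH" and \<theta>: "\<theta> \<in> unit_sphere b" and r: "0 < r"
    and X: "X \<in> hor_space b \<theta>" "X' \<in> hor_space b \<theta>"
    and Y: "Y \<in> vert_space \<theta>" "Y' \<in> vert_space \<theta>"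
  shows "chg (polar b r \<theta>) (polar_diff b r \<theta> (a, X + Y)) (polar_diff b r \<theta> (a', X' + Y')) =
    a * a' + (sinh r)\<^sup>2 * chg b X X' + (sinh r)\<^sup>2 * (cosh r)\<^sup>2 * chg b Y Y'"
proof -
  define t where "t = tanh r"
  define y where "y = t *\<^sub>R \<theta>"
  define h where "h = bergman b X X'"
  have t: "t\<^sup>2 < 1" unfolding t_def using tanh_square_less_1[OF b \<theta>] .
  have th: "bergman b \<theta> \<theta> = 1" using \<theta> by (simp add: bergman_self(1)[OF b] unit_sphere_def)
  have hor: "bergman b X \<theta> = 0" "bergman b \<theta> X = 0" if "X \<in> hor_space b \<theta>" for X
  proof -
    have "chg b X \<theta> = 0" "chg b X (\<i> *s \<theta>) = 0"
      using that by (auto simp: hor_space_def vert_space_def span_base)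
    then show "bergman b X \<theta> = 0" by (simp add: chg_def bergman_simps complex_eq_iff)
    then show "bergman b \<theta> X = 0" using cnj_bergman[of b X \<theta>] by simp
  qed
  obtain c c' where c: "Y = c *\<^sub>R (\<i> *s \<theta>)" "Y' = c' *\<^sub>R (\<i> *s \<theta>)"
    using Y by (auto simp: vert_space_def span_singleton)
  have pd: "polar_diff b r \<theta> = (\<lambda>(a, X). proj_diff b y ((a * (1 - t\<^sup>2)) *\<^sub>R \<theta> + t *\<^sub>R X))"
    unfolding polar_diff_def t_def y_def
    by (rule frechet_derivative_at[symmetric], rule polar_has_derivative[OF b \<theta>])
  have Hy: "bergman b y y = of_real (t\<^sup>2)" by (simp add: y_def bergman_simps th power2_eq_square)
  have "chg b y y < 1" using t by (simp add: chg_def Hy flip: of_real_power)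
  then have D0: "proj_den b y \<noteq> 0" by (rule proj_den_nonzero[OF b])
  have ne: "bergman b y y \<noteq> 1" using t unfolding Hy by (metis less_irrefl of_real_eq_1_iff)
  have B: "bergman b (p *\<^sub>R \<theta> + t *\<^sub>R (X + Y)) (p' *\<^sub>R \<theta> + t *\<^sub>R (X' + Y')) =
      (of_real p + of_real (t * c) * \<i>) * (of_real p' - of_real (t * c') * \<i>) + of_real (t\<^sup>2) * h"
    "bergman b (p *\<^sub>R \<theta> + t *\<^sub>R (X + Y)) y = of_real t * (of_real p + of_real (t * c) * \<i>)"
    "bergman b y (p' *\<^sub>R \<theta> + t *\<^sub>R (X' + Y')) = of_real t * (of_real p' - of_real (t * c') * \<i>)"
    for p p'
    unfolding y_def c bergman_simps th hor[OF X(1)] hor[OF X(2)] h_def[symmetric]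
    by (simp_all add: algebra_simps power2_eq_square)
  have "bergman (proj_map b y) (polar_diff b r \<theta> (a, X + Y)) (polar_diff b r \<theta> (a', X' + Y')) =
     ((1 - of_real (t\<^sup>2)) * ((of_real (a * (1 - t\<^sup>2)) + of_real (t * c) * \<i>) *
         (of_real (a' * (1 - t\<^sup>2)) - of_real (t * c') * \<i>) + of_real (t\<^sup>2) * h)
      + (of_real t * (of_real (a * (1 - t\<^sup>2)) + of_real (t * c) * \<i>)) *
        (of_real t * (of_real (a' * (1 - t\<^sup>2)) - of_real (t * c') * \<i>))) / (1 - of_real (t\<^sup>2))\<^sup>2"
    unfolding pd prod.case bergman_proj_map[OF b D0 ne] Hy B ..
  also have "\<dots> = ((of_real (a * (1 - t\<^sup>2)) + of_real (t * c) * \<i>) *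
         (of_real (a' * (1 - t\<^sup>2)) - of_real (t * c') * \<i>) + of_real (t\<^sup>2 * (1 - t\<^sup>2)) * h) / of_real ((1 - t\<^sup>2)\<^sup>2)"
    by (rule arg_cong2[of _ _ _ _ "(/)"]) (simp_all add: algebra_simps power2_eq_square)
  finally have "chg (polar b r \<theta>) (polar_diff b r \<theta> (a, X + Y)) (polar_diff b r \<theta> (a', X' + Y')) =
      (a * (1 - t\<^sup>2) * (a' * (1 - t\<^sup>2)) + t * c * (t * c') + t\<^sup>2 * (1 - t\<^sup>2) * Re h) / (1 - t\<^sup>2)\<^sup>2"
    unfolding chg_def polar_eq_proj_map y_def t_def[symmetric] Re_divide_of_real by simp
  also have "\<dots> = a * a' + t\<^sup>2 / (1 - t\<^sup>2) * Re h + t\<^sup>2 / (1 - t\<^sup>2)\<^sup>2 * (c * c')"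
  proof -
    have "(a * u * (a' * u) + t * c * (t * c') + t\<^sup>2 * u * Re h) / u\<^sup>2 =
        a * a' + t\<^sup>2 / u * Re h + t\<^sup>2 / u\<^sup>2 * (c * c')" if "u \<noteq> 0" for u
      using that by (simp add: field_simps power2_eq_square)
    then show ?thesis using t by simp
  qed
  finally have *: "chg (polar b r \<theta>) (polar_diff b r \<theta> (a, X + Y)) (polar_diff b r \<theta> (a', X' + Y')) =
      a * a' + t\<^sup>2 / (1 - t\<^sup>2) * Re h + t\<^sup>2 / (1 - t\<^sup>2)\<^sup>2 * (c * c')" .
  have t12: "t\<^sup>2 / (1 - t\<^sup>2) = (sinh r)\<^sup>2" "t\<^sup>2 / (1 - t\<^sup>2)\<^sup>2 = (sinh r)\<^sup>2 * (cosh r)\<^sup>2"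
  proof -
    have t2: "t\<^sup>2 = (sinh r)\<^sup>2 / (cosh r)\<^sup>2" by (simp add: t_def tanh_def power_divide)
    have "1 - t\<^sup>2 = ((cosh r)\<^sup>2 - (sinh r)\<^sup>2) / (cosh r)\<^sup>2"
      unfolding t2 by (simp add: diff_divide_distrib)
    then have t1: "1 - t\<^sup>2 = 1 / (cosh r)\<^sup>2" using hyperbolic_pythagoras[of r] by simp
    show "t\<^sup>2 / (1 - t\<^sup>2) = (sinh r)\<^sup>2" unfolding t1 unfolding t2 by simp
    show "t\<^sup>2 / (1 - t\<^sup>2)\<^sup>2 = (sinh r)\<^sup>2 * (cosh r)\<^sup>2"
      unfolding t1 unfolding t2 by (simp add: power2_eq_square)
  qed
  have "Re h = chg b X X'" "c * c' = chg b Y Y'" by (simp_all add: h_def c chg_def bergman_simps th)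
  then show ?thesis using * unfolding t12 by simp
qed

end

theory Submission
  imports Defs
begin

text \<open>
  Write \<open>S = sinh r\<close>, \<open>C = cosh r\<close>, \<open>x = S\<^sup>2\<close> and \<open>s = exp (t \<phi>(\<theta>))\<close>. The volume radius is \<open>sinh r\<close>, so
  the map \<open>F\<close> keeps \<open>\<theta>\<close> and moves \<open>r\<close> to \<open>r'\<close> with \<open>sinh r' = s S\<close>; put \<open>C' = cosh r'\<close>. In polar
  coordinates its differential is
  \<open>(\<xi>, X) \<mapsto> (s C \<xi> / C' + s S t d\<phi>(X) / C', X)\<close>
  (\<open>radial_map_differential\<close>): triangular with respect to radial direction plus sphere, with the
  factors \<open>s C / C'\<close>, \<open>s\<close> (\<open>n - 2\<close> times) and \<open>s C' / C\<close> on the diagonal once the metric is taken into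
  account. Hence the Riemannian determinant is \<open>s\<^sup>n\<close>, and inverting the transpose gives
  \<open>J\<^sup>2 = s\<^sup>2\<^sup>n\<^sup>-\<^sup>2 (\<alpha>\<^sup>2 C'\<^sup>2 / C\<^sup>2 + |v - (t \<alpha> / C) \<nabla>\<^sub>H\<phi>|\<^sup>2 + (C\<^sup>2 / C'\<^sup>2) |w - (t \<alpha> / C\<^sup>2) \<nabla>\<^sub>V\<phi>|\<^sup>2)\<close>,
  where \<open>C'\<^sup>2 = 1 + s\<^sup>2 x\<close> and the gradients on the unit sphere are carried isometrically to the horizontal
  and vertical directions at the point (\<open>J_Pi_formula\<close>).

  This depends on \<open>\<phi>\<close> only through the value and the gradient of \<open>\<phi>\<close> at \<open>\<theta>\<close>, and both enter multiplied by
  \<open>t\<close>. So the second \<open>t\<close>-derivative at 0 is a quadratic form in \<open>(\<phi>(\<theta>), \<nabla>\<phi>(\<theta>))\<close>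
  (\<open>deriv_jacobian_profile\<close>). For \<open>\<phi>\<^sub>j = \<langle>\<cdot>, e\<^sub>j\<rangle>\<close> all entries of this form are products of inner products
  with \<open>e\<^sub>j\<close>, and summing over \<open>j\<close> is \<open>parseval\<close>: the mixed terms vanish because \<open>\<theta>\<close>, the horizontal
  and the vertical directions are orthogonal, and the others give \<open>1\<close>, \<open>n - 2\<close>, \<open>\<beta> / x\<close> and
  \<open>\<gamma> / (x (1 + x))\<close>. Eliminating \<open>\<alpha>\<^sup>2 = 1 - \<beta> - \<gamma>\<close> leaves a polynomial identity.

  The analytic work is done in the chart \<open>proj_map b\<close>, in which geodesics from \<open>b\<close> are rays. There \<open>F\<close>
  is \<open>y \<mapsto> \<kappa>(y) y\<close> for a scalar \<open>\<kappa>\<close>, whose differential is a multiple of the identity plus an operator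
  of rank one, and the Bergman metric is a rank-two update of a constant form. All determinants thus
  come from \<open>det (1 + a b\<^sup>T) = 1 + a \<bullet> b\<close>. Since \<open>J\<close> is a norm, the
  square of the determinant of \<open>F\<close> suffices, and orientations do not enter.
\<close>

section \<open>Determinants of real-linear maps of a complex vector space\<close>

text \<open>
  A permutation that fixes every index except \<open>k\<close> is the identity, so only the diagonal contributes to
  the Leibniz expansion.
\<close>

lemma det_one_row:
  fixes A :: "real ^ 'n ^ 'n"
  assumes A: "\<And>i j. i \<noteq> k \<Longrightarrow> A $ i $ j = (if i = j then 1 else 0)"
  shows "det A = A $ k $ k"
proof -
  have "of_int (sign p) * (\<Prod>i\<in>UNIV. A $ i $ p i) = 0"
    if "p permutes UNIV" "p \<noteq> id" for p
  proof -
    have "inj p" using that(1) by (rule permutes_inj)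
    have "\<exists>i. i \<noteq> k \<and> p i \<noteq> i"
    proof (rule ccontr)
      assume "\<not> ?thesis"
      then have *: "p i = i" if "i \<noteq> k" for i using that by blast
      then have "p k = k" using \<open>inj p\<close> by (metis injD)
      with * have "p = id" by (metis eq_id_iff)
      with that(2) show False ..
    qed
    then obtain i where "i \<noteq> k" "p i \<noteq> i" by blast
    then have "A $ i $ p i = 0" using A[of i "p i"] by simp
    then have "(\<Prod>i\<in>UNIV. A $ i $ p i) = 0" by (intro prod_zero) auto
    then show ?thesis by simp
  qed
  then have "det A = (\<Sum>p\<in>{id}. of_int (sign p) * (\<Prod>i\<in>UNIV. A $ i $ p i))"
    unfolding det_def by (intro sum.mono_neutral_right) (auto simp: permutes_id finite_permutations)
  also have "\<dots> = (\<Prod>i\<in>UNIV. A $ i $ i)" by simp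
  also have "\<dots> = (\<Prod>i\<in>{k}. A $ i $ i)" by (rule prod.mono_neutral_right) (auto simp: A)
  finally show ?thesis by simp
qed

text \<open>
  An orthogonal change of basis that sends \<open>a\<close> to a multiple of a basis vector turns the matrix into one
  that differs from the identity in a single row.
\<close>

lemma det_rank_one_update:
  fixes a b :: "real ^ 'n"
  shows "det (\<chi> i j. (if i = j then 1 else 0) + a $ i * b $ j :: real ^ 'n ^ 'n) = 1 + a \<bullet> b"
proof (cases "a = 0")
  case True
  then have "(\<chi> i j. (if i = j then 1 else 0) + a $ i * b $ j) = (mat 1 :: real ^ 'n ^ 'n)"
    by (simp add: mat_def vec_eq_iff)
  with True show ?thesis by simp
next
  case False
  define M where "M = (\<chi> i j. (if i = j then 1 else 0) + a $ i * b $ j :: real ^ 'n ^ 'n)"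
  \<comment> \<open>Any index serves as the one to which \<open>a\<close> is rotated.\<close>
  obtain k :: 'n where True by blast
  obtain R :: "real ^ 'n ^ 'n" where R: "orthogonal_matrix R" and Rk: "R *v axis k 1 = a /\<^sub>R norm a"
    using orthogonal_matrix_exists_basis[of "a /\<^sub>R norm a" k] False by auto
  have RR: "transpose R ** R = mat 1" using R by (simp add: orthogonal_matrix_def)
  have Mv: "M *v u = u + (b \<bullet> u) *\<^sub>R a" for u
  proof -
    have "((if i = j then 1 else 0) + a $ i * b $ j) * u $ j =
        (if i = j then u $ j else 0) + b $ j * u $ j * a $ i" for i j
      by (simp add: algebra_simps)
    then show ?thesis
      by (simp add: M_def matrix_vector_mult_def vec_eq_iff inner_vec_def sum.distrib sum_distrib_right)
  qed
  define N where "N = transpose R ** M ** R"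
  have Nv: "N *v u = u + (norm a * (b \<bullet> (R *v u))) *\<^sub>R axis k 1" for u
  proof -
    have ak: "transpose R *v a = norm a *\<^sub>R axis k 1"
    proof -
      have "transpose R *v (R *v axis k 1) = axis k 1"
        by (simp add: matrix_vector_mul_assoc RR)
      then have "transpose R *v (a /\<^sub>R norm a) = axis k 1" by (simp add: Rk)
      then have "norm a *\<^sub>R (transpose R *v (a /\<^sub>R norm a)) = norm a *\<^sub>R axis k 1" by simp
      then show ?thesis using False
        by (simp add: matrix_vector_mult_scaleR)
    qed
    have "N *v u = transpose R *v (M *v (R *v u))"
      by (simp add: N_def matrix_vector_mul_assoc matrix_mul_assoc)
    also have "\<dots> = transpose R *v (R *v u) + (b \<bullet> (R *v u)) *\<^sub>R (transpose R *v a)"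
      by (simp add: Mv matrix_vector_right_distrib matrix_vector_mult_scaleR)
    finally show ?thesis unfolding ak matrix_vector_mul_assoc RR by (simp add: mult.commute)
  qed
  have Nij: "N $ i $ j = (N *v axis j 1) $ i" for i j
    by (simp add: matrix_vector_mult_basis column_def)
  have "det N = N $ k $ k"
    by (rule det_one_row) (simp add: Nij Nv, simp add: axis_def)
  also have "\<dots> = 1 + a \<bullet> b"
    using False by (simp add: Nij Nv Rk inner_commute)
  finally have N: "det N = 1 + a \<bullet> b" .
  have "det (transpose R) * det R = 1"
    using RR by (metis det_I det_mul)
  then have "det N = det M" by (simp add: N_def det_mul mult.commute mult.left_commute)
  with N show ?thesis by (simp add: M_def)
qed

lemma inner_hprod: "u \<bullet> v = Re (hprod u v)"
  by (simp add: inner_vec_def hprod_def inner_complex_def)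

lemma sum_UNIV_Plus:
  fixes f :: "'a::finite + 'b::finite \<Rightarrow> 'c::comm_monoid_add"
  shows "(\<Sum>k\<in>UNIV. f k) = (\<Sum>i\<in>UNIV. f (Inl i)) + (\<Sum>i\<in>UNIV. f (Inr i))"
  by (simp flip: UNIV_Plus_UNIV add: sum.Plus)

lemma real_frame_inner: "real_frame (Inl i) \<bullet> u = Re (u $ i)" "real_frame (Inr i) \<bullet> u = Im (u $ i)"
  by (simp_all add: real_frame_def inner_axis' inner_complex_def)

lemma real_frame_orthonormal: "real_frame i \<bullet> real_frame j = (if i = j then 1 else 0)"
  by (cases i; cases j) (simp_all add: real_frame_inner, simp_all add: real_frame_def axis_def)

lemma real_frame_inner_sum: "(\<Sum>k\<in>UNIV. (real_frame k \<bullet> u) * (real_frame k \<bullet> v)) = u \<bullet> v"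
  unfolding sum_UNIV_Plus real_frame_inner
  by (simp add: inner_vec_def inner_complex_def sum.distrib)

lemma real_frame_expansion: "(\<Sum>k\<in>UNIV. (real_frame k \<bullet> u) *\<^sub>R real_frame k) = u"
proof (rule vector_eq_rdot[THEN iffD1], rule allI)
  fix v show "(\<Sum>k\<in>UNIV. (real_frame k \<bullet> u) *\<^sub>R real_frame k) \<bullet> v = u \<bullet> v"
    by (simp add: inner_sum_left real_frame_inner_sum)
qed

text \<open>
  The determinant factor in \<open>metric_det\<close> and the Gram determinant of an arbitrary form, as functions of
  the map and of the form: their behaviour under composition then replaces matrix computations.
\<close>

definition real_det :: "(complex ^ 'm \<Rightarrow> complex ^ 'm) \<Rightarrow> real" where
  "real_det L = det (\<chi> i j. real_frame i \<bullet> L (real_frame j) :: real ^ ('m + 'm) ^ ('m + 'm))"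

definition gram_form :: "(complex ^ 'm \<Rightarrow> complex ^ 'm \<Rightarrow> real) \<Rightarrow> real" where
  "gram_form B = det (\<chi> i j. B (real_frame i) (real_frame j) :: real ^ ('m + 'm) ^ ('m + 'm))"

lemma gram_form_right_compose:
  fixes T :: "complex ^ 'm \<Rightarrow> complex ^ 'm"
  assumes B: "\<And>u. linear (B u)"
  shows "gram_form (\<lambda>u v. B u (T v)) = gram_form B * real_det T"
proof -
  have "B u (T v) = (\<Sum>k\<in>UNIV. B u (real_frame k) * (real_frame k \<bullet> T v))" for u v
    by (subst (1) real_frame_expansion[of "T v", symmetric])
       (simp add: linear_sum[OF B] linear_scale[OF B] mult.commute)
  then show ?thesis
    unfolding gram_form_def real_det_def det_mul[symmetric]
    by (simp add: matrix_matrix_mult_def)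
qed

lemma gram_form_left_compose:
  fixes T :: "complex ^ 'm \<Rightarrow> complex ^ 'm"
  assumes B: "\<And>v. linear (\<lambda>u. B u v)"
  shows "gram_form (\<lambda>u v. B (T u) v) = real_det T * gram_form B"
proof -
  have tr: "gram_form C = gram_form (\<lambda>u v. C v u)" for C :: "complex ^ 'm \<Rightarrow> complex ^ 'm \<Rightarrow> real"
    unfolding gram_form_def by (subst det_transpose[symmetric]) (simp add: transpose_def)
  show ?thesis
    by (subst tr, subst gram_form_right_compose[of "\<lambda>u v. B v u" T, OF B], subst (2) tr) simp
qed

lemma gram_form_inner: "gram_form ((\<bullet>) :: complex ^ 'm \<Rightarrow> complex ^ 'm \<Rightarrow> real) = 1"
proof -
  have "(\<chi> i j. real_frame i \<bullet> real_frame j) = (mat 1 :: real ^ ('m + 'm) ^ ('m + 'm))"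
    by (simp add: real_frame_orthonormal mat_def)
  then show ?thesis by (simp add: gram_form_def)
qed

lemma real_det_compose:
  assumes "linear S"
  shows "real_det (\<lambda>u. S (T u)) = real_det S * real_det T"
proof -
  have "linear (\<lambda>v. u \<bullet> S v)" for u
    using assms by (simp add: linear_iff inner_add_right)
  from gram_form_right_compose[of "\<lambda>u v. u \<bullet> S v" T, OF this]
  show ?thesis by (simp add: gram_form_def real_det_def)
qed

lemma real_det_scaleR:
  "real_det (\<lambda>u :: complex ^ 'm. c *\<^sub>R u) = c ^ (2 * CARD('m))"
proof -
  have "real_det (\<lambda>u :: complex ^ 'm. c *\<^sub>R u) =
      det (\<chi> i j. if i = j then c else 0 :: real ^ ('m + 'm) ^ ('m + 'm))"
    unfolding real_det_def by (rule arg_cong[where f = det]) (simp add: vec_eq_iff real_frame_orthonormal)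
  also have "\<dots> = c ^ (2 * CARD('m))"
    by (subst det_diagonal) (simp_all add: mult_2)
  finally show ?thesis .
qed

lemma real_det_rank_one:
  assumes l: "linear l"
  shows "real_det (\<lambda>u. u + l u *\<^sub>R a) = 1 + l a"
proof -
  have "real_det (\<lambda>u. u + l u *\<^sub>R a) = 
     det (\<chi> i j. (if i = j then 1 else 0) + (\<chi> i. real_frame i \<bullet> a) $ i * (\<chi> j. l (real_frame j)) $ j)"
    unfolding real_det_def
    by (rule arg_cong[where f = det]) (simp add: vec_eq_iff real_frame_orthonormal inner_add_right mult.commute)
  also have "\<dots> = 1 + (\<Sum>k\<in>UNIV. (real_frame k \<bullet> a) * l (real_frame k))"
    by (subst det_rank_one_update) (simp add: inner_vec_def)
  also have "(\<Sum>k\<in>UNIV. (real_frame k \<bullet> a) * l (real_frame k)) = l (\<Sum>k\<in>UNIV. (real_frame k \<bullet> a) *\<^sub>R real_frame k)"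
    by (simp add: linear_sum[OF l] linear_scale[OF l])
  finally show ?thesis by (simp add: real_frame_expansion)
qed

lemma real_det_scaled_rank_one:
  fixes a :: "complex ^ 'm"
  assumes l: "linear l" and c: "c \<noteq> 0"
  shows "real_det (\<lambda>u. c *\<^sub>R u + l u *\<^sub>R a) = c ^ (2 * CARD('m)) * (1 + l a / c)"
proof -
  have l': "linear (\<lambda>u. l u / c)"
    using l by (simp add: linear_iff add_divide_distrib)
  have "(\<lambda>u. c *\<^sub>R u + l u *\<^sub>R a) = (\<lambda>u. c *\<^sub>R (u + (l u / c) *\<^sub>R a))"
    using c by (simp add: scaleR_add_right)
  moreover have "linear (\<lambda>u :: complex ^ 'm. c *\<^sub>R u)" by (simp add: linear_iff scaleR_add_right)
  ultimately show ?thesis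
    by (simp only: real_det_compose[of "\<lambda>u. c *\<^sub>R u" "\<lambda>u. u + (l u / c) *\<^sub>R a"]
        real_det_rank_one[OF l'] real_det_scaleR)
qed

lemma scaleR_eq_smult: "x *\<^sub>R (u :: complex ^ 'm) = of_real x *s u"
  by (simp add: vec_eq_iff scaleR_conv_of_real[where 'a = complex])

text \<open>
  The complex rank-one update is the product of the real rank-one updates in the directions \<open>y\<close> and
  \<open>\<i> y\<close>, because \<open>Re (h (\<i> y)) = 0\<close>.
\<close>

lemma real_det_complex_direction:
  fixes y :: "complex ^ 'm" and h :: "complex ^ 'm \<Rightarrow> complex"
  assumes add: "\<And>u v. h (u + v) = h u + h v" and smult: "\<And>c u. h (c *s u) = c * h u"
    and hy: "h y = of_real q"
  shows "real_det (\<lambda>u. u + h u *s y) = (1 + q)\<^sup>2"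
proof -
  have smR: "h (x *\<^sub>R u) = x *\<^sub>R h u" for x u
    by (simp add: scaleR_eq_smult smult scaleR_conv_of_real)
  have l1: "linear (\<lambda>u. Re (h u))" and l2: "linear (\<lambda>u. Im (h u))"
    by (simp_all add: linear_iff add smR)
  have split: "c *s y = Re c *\<^sub>R y + Im c *\<^sub>R (\<i> *s y)" for c
    by (simp add: vec_eq_iff complex_eq_iff)
  have "(\<lambda>u. u + h u *s y) =
      (\<lambda>u. (u + Im (h u) *\<^sub>R (\<i> *s y)) + Re (h (u + Im (h u) *\<^sub>R (\<i> *s y))) *\<^sub>R y)"
    by (simp add: fun_eq_iff split[of "h _"] add smR smult hy)
  moreover have "linear (\<lambda>u. u + Re (h u) *\<^sub>R y)"
    using l1 by (simp add: linear_iff algebra_simps)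
  ultimately show ?thesis
    by (simp add: real_det_compose[of "\<lambda>u. u + Re (h u) *\<^sub>R y" "\<lambda>u. u + Im (h u) *\<^sub>R (\<i> *s y)"]
        real_det_rank_one[OF l1] real_det_rank_one[OF l2] smult hy power2_eq_square)
qed

text \<open>
  The expression on the left is the Bergman metric of the unit ball at the point \<open>y\<close>, with \<open>H\<close> in place
  of the standard Hermitian form. It is used twice: with \<open>H = hprod\<close> for the volume density of
  complex hyperbolic space, and with \<open>H = bergman b\<close> for the metric in the chart \<open>proj_map b\<close>. The update
  is \<open>H u (T v)\<close> with \<open>T\<close> a multiple of the identity plus a complex rank-one map.
\<close>

lemma gram_form_hermitian_update:
  fixes H :: "complex ^ 'm \<Rightarrow> complex ^ 'm \<Rightarrow> complex" and c \<rho> :: real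
  assumes H: "\<And>u v w. H (u + v) w = H u w + H v w" "\<And>u v w. H u (v + w) = H u v + H u w"
     "\<And>c u v. H (c *s u) v = c * H u v" "\<And>c u v. H u (c *s v) = cnj c * H u v"
     "\<And>u v. cnj (H u v) = H v u"
    and y: "H y y = of_real \<rho>" and \<rho>: "\<rho> \<noteq> 1"
  shows "gram_form (\<lambda>u v. Re (((1 - of_real \<rho>) * H u v + H u y * H y v) / (1 - of_real \<rho>)\<^sup>2)) =
     gram_form (\<lambda>u v. Re (H u v)) / (1 - \<rho>) ^ (2 * CARD('m) + 2)"
proof -
  define s where "s = 1 / (1 - \<rho>)"
  have s: "s * (1 - \<rho>) = 1" using \<rho> by (simp add: s_def)
  have cs: "of_real s * (1 - of_real \<rho>) = (1 :: complex)"
    by (metis s of_real_1 of_real_diff of_real_mult)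
  define h where "h u = of_real s * H u y" for u
  define T where "T = (\<lambda>u. s *\<^sub>R (u + h u *s y))"
  have lin: "linear (\<lambda>v. Re (H u v))" for u
    unfolding linear_iff scaleR_eq_smult by (simp add: H)
  have "((1 - of_real \<rho>) * H u v + H u y * H y v) / (1 - of_real \<rho>)\<^sup>2 = H u (T v)" for u v
  proof -
    define k where "k = 1 - complex_of_real \<rho>"
    have k: "of_real s * k = 1" using cs by (simp add: k_def)
    then have "k \<noteq> 0" by auto
    then have sk: "of_real s = 1 / k" using k by (simp add: field_simps)
    have "H u (T v) = of_real s * H u v + of_real s * of_real s * (H u y * H y v)"
      unfolding T_def h_def scaleR_eq_smult by (simp add: H algebra_simps)
    also have "\<dots> = (k * H u v + H u y * H y v) / k\<^sup>2"
      using \<open>k \<noteq> 0\<close> by (simp add: sk field_simps power2_eq_square)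
    finally show ?thesis by (simp add: k_def)
  qed
  then have "gram_form (\<lambda>u v. Re (((1 - of_real \<rho>) * H u v + H u y * H y v) / (1 - of_real \<rho>)\<^sup>2))
      = gram_form (\<lambda>u v. Re (H u v)) * real_det T"
    using gram_form_right_compose[of "\<lambda>u v. Re (H u v)" T, OF lin] by simp
  also have "real_det T = s ^ (2 * CARD('m)) * (1 + s * \<rho>)\<^sup>2"
    unfolding T_def
    by (subst real_det_compose[of "\<lambda>u. s *\<^sub>R u" "\<lambda>u. u + h u *s y"])
       (simp_all add: linear_iff scaleR_add_right real_det_scaleR,
        rule disjI2, rule real_det_complex_direction, simp_all add: h_def H y algebra_simps)
  also have "1 + s * \<rho> = s" using s by (simp add: algebra_simps)
  finally show ?thesis by (simp add: s_def power_divide power_add power2_eq_square)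
qed

lemma gram_det_eq:
  assumes "z \<in> CH"
  shows "gram_det (z :: complex ^ 'm) = 1 / (1 - (norm z)\<^sup>2) ^ (2 * CARD('m) + 2)"
proof -
  have "gram_form (\<lambda>u v. Re (((1 - of_real ((norm z)\<^sup>2)) * hprod u v + hprod u z * hprod z v) / (1 - of_real ((norm z)\<^sup>2))\<^sup>2)) =
     gram_form (\<lambda>u v :: complex ^ 'm. Re (hprod u v)) / (1 - (norm z)\<^sup>2) ^ (2 * CARD('m) + 2)"
    by (rule gram_form_hermitian_update[where H = hprod and y = z and \<rho> = "(norm z)\<^sup>2"]) (use assms CH_iff[of z] in \<open>simp_all add: hprod_simps cnj_hprod hprod_self\<close>)
  moreover have "gram_form (\<lambda>u v :: complex ^ 'm. Re (hprod u v)) = 1"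
    unfolding inner_hprod[symmetric] by (rule gram_form_inner)
  ultimately show ?thesis
    by (simp only: gram_form_def gram_det_def chg_def bergman_def of_real_diff of_real_1 of_real_power)
qed

lemma gram_det_pos:
  assumes "z \<in> CH"
  shows "gram_det z > 0"
  using assms by (simp add: gram_det_eq CH_iff)

lemma metric_det_square:
  assumes "z \<in> CH" "w \<in> CH"
  shows "(metric_det z w L)\<^sup>2 = (real_det L)\<^sup>2 * gram_det w / gram_det z"
  using gram_det_pos[OF assms(1)] gram_det_pos[OF assms(2)]
  by (simp add: metric_det_def real_det_def power_mult_distrib power_divide)

section \<open>The Bergman metric as a bilinear form\<close>

lemma bilinear_chg: "bounded_bilinear (chg b)"
  unfolding chg_def
proof (rule bilinear_conv_bounded_bilinear[THEN iffD1], unfold bilinear_def, intro conjI allI)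
qed (simp_all add: linear_iff bergman_simps)

lemmas chg_simps = bounded_bilinear.add_left[OF bilinear_chg] bounded_bilinear.add_right[OF bilinear_chg]
  bounded_bilinear.diff_left[OF bilinear_chg] bounded_bilinear.diff_right[OF bilinear_chg]
  bounded_bilinear.scaleR_left[OF bilinear_chg] bounded_bilinear.scaleR_right[OF bilinear_chg]
  bounded_bilinear.minus_left[OF bilinear_chg] bounded_bilinear.minus_right[OF bilinear_chg]
  bounded_bilinear.zero_left[OF bilinear_chg] bounded_bilinear.zero_right[OF bilinear_chg]

lemma chg_commute: "chg b u v = chg b v u"
  unfolding chg_def by (subst cnj_bergman[symmetric]) simp

lemma chg_has_derivative [derivative_intros]:
  "((\<lambda>y. chg b y y) has_derivative (\<lambda>a. 2 * chg b y a)) (at y)"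
  using bounded_bilinear.FDERIV[OF bilinear_chg has_derivative_ident has_derivative_ident, of b y UNIV]
  by (simp add: chg_commute[of b _ y])

lemma open_unit_ball: "open {y. chg b y y < 1}"
proof -
  have "continuous_on UNIV (\<lambda>y. chg b y y)"
    using chg_has_derivative by (intro continuous_at_imp_continuous_on ballI has_derivative_continuous)
  then show ?thesis by (simp add: open_Collect_less continuous_on_const)
qed

section \<open>The projective chart\<close>

definition proj_inv :: "complex ^ 'm \<Rightarrow> complex ^ 'm \<Rightarrow> complex ^ 'm" where
  "proj_inv b z = (1 / (1 - hprod (z - b) b / of_real (1 - (norm b)\<^sup>2))) *s (z - b)"

lemma proj_inv_den:
  assumes "proj_den b y \<noteq> 0"
  shows "1 - hprod (proj_map b y - b) b / of_real (1 - (norm b)\<^sup>2) = 1 / proj_den b y"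
proof -
  have "hprod (proj_map b y - b) b / of_real (1 - (norm b)\<^sup>2)
      = (1 / proj_den b y) * (hprod y b / of_real (1 - (norm b)\<^sup>2))"
    by (simp add: proj_map_def hprod_simps)
  also have "hprod y b / of_real (1 - (norm b)\<^sup>2) = proj_den b y - 1" by (simp add: proj_den_def)
  finally show ?thesis using assms by (simp add: field_simps)
qed

lemma proj_inv_proj_map:
  assumes "proj_den b y \<noteq> 0"
  shows "proj_inv b (proj_map b y) = y"
  unfolding proj_inv_def proj_inv_den[OF assms] using assms by (simp add: proj_map_def)

lemma proj_inv_differentiable:
  assumes D: "proj_den b y \<noteq> 0"
  shows "\<exists>I. (proj_inv b has_derivative I) (at (proj_map b y))"
proof -
  have "((\<lambda>z. 1 - hprod (z - b) b / of_real (1 - (norm b)\<^sup>2)) has_derivative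
      (\<lambda>a. - (hprod a b / of_real (1 - (norm b)\<^sup>2)))) (at (proj_map b y))"
    by (rule has_derivative_eq_rhs, (rule derivative_intros bounded_linear.has_derivative[OF bounded_linear_divide]
          bounded_linear.has_derivative[OF bounded_linear_hprod])+) simp
  from Deriv.has_derivative_inverse[OF _ this]
  obtain I0 where I0: "((\<lambda>z. inverse (1 - hprod (z - b) b / of_real (1 - (norm b)\<^sup>2))) has_derivative I0) (at (proj_map b y))"
    unfolding proj_inv_den[OF D] using D by auto
  from bounded_bilinear.FDERIV[OF bounded_bilinear_vector_smult this
      has_derivative_diff[OF has_derivative_ident has_derivative_const, of b]]
  show ?thesis unfolding proj_inv_def[abs_def] by (auto simp: divide_inverse)
qed

text \<open>
  The explicit inverse \<open>proj_inv\<close> is differentiable; the chain rule gives one of the two identities for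
  its derivative, and equality of dimensions the other one.
\<close>

lemma proj_map_chart:
  fixes b y :: "complex ^ 'm"
  assumes b: "b \<in> CH" and y: "chg b y y < 1"
  obtains I where "(proj_inv b has_derivative I) (at (proj_map b y))"
    "\<And>a. I (proj_diff b y a) = a" "\<And>a. proj_diff b y (I a) = a"
proof -
  note D = proj_den_nonzero[OF b y]
  obtain I where I: "(proj_inv b has_derivative I) (at (proj_map b y))"
    using proj_inv_differentiable[OF D] by blast
  note P = proj_map_has_derivative[OF D]
  have "((\<lambda>y. proj_inv b (proj_map b y)) has_derivative (\<lambda>a. I (proj_diff b y a))) (at y)"
    by (rule has_derivative_compose[OF P I])
  then have "((\<lambda>y. y) has_derivative (\<lambda>a. I (proj_diff b y a))) (at y)"
    by (rule has_derivative_transform_within_open[OF _ open_unit_ball])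
       (use y in \<open>auto simp: proj_inv_proj_map proj_den_nonzero[OF b]\<close>)
  then have id: "(\<lambda>a. I (proj_diff b y a)) = (\<lambda>a. a)"
    by (rule has_derivative_unique[OF _ has_derivative_ident])
  then have 1: "I (proj_diff b y a) = a" for a by (rule fun_cong)
  moreover have "proj_diff b y (I a) = a" for a
  proof -
    have "I \<circ> proj_diff b y = id" using id by (simp add: comp_def id_def)
    then have "proj_diff b y \<circ> I = id"
      using linear_inverse_left[OF has_derivative_linear[OF I] has_derivative_linear[OF P]] by blast
    then show ?thesis by (metis comp_apply id_apply)
  qed
  ultimately show thesis using I that by blast
qed

section \<open>The radial maps\<close>

lemma vol_radius_sinh:
  assumes n: "n > 0" and r: "r \<ge> 0"
  shows "vol_radius n r = sinh r"
proof -
  have "((\<lambda>s. sinh s ^ (n - 1) * cosh s) has_integral (sinh r ^ n / n - sinh 0 ^ n / n)) {0..r}"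
  proof (rule fundamental_theorem_of_calculus[OF r])
    fix x assume "x \<in> {0..r}"
    have "((\<lambda>s. sinh s ^ n / n) has_real_derivative sinh x ^ (n - 1) * cosh x) (at x within {0..r})"
      using n by (auto intro!: derivative_eq_intros)
    then show "((\<lambda>s. sinh s ^ n / n) has_vector_derivative sinh x ^ (n - 1) * cosh x) (at x within {0..r})"
      by (rule has_real_derivative_iff_has_vector_derivative[THEN iffD1])
  qed
  then have "integral {0..r} (\<lambda>s. sinh s ^ (n - 1) * cosh s) = sinh r ^ n / n"
    using n by (simp add: integral_unique)
  then show ?thesis
    unfolding vol_radius_def using n r by (simp add: real_root_power_cancel)
qed

lemma inv_vol_radius:
  assumes n: "n > 0" and u: "u > 0"
  shows "inv_into {0<..} (vol_radius n) u = arsinh u"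
proof (rule inv_into_f_eq)
  show "inj_on (vol_radius n) {0<..}"
    using n by (auto simp: inj_on_def vol_radius_sinh)
  show "arsinh u \<in> {0<..}" using u by simp
  then have "arsinh u \<ge> 0" by (simp add: less_imp_le)
  then show "vol_radius n (arsinh u) = u" using n by (simp add: vol_radius_sinh)
qed

lemma polar_coords_polar:
  assumes "b \<in> CH" "0 < r" "\<theta> \<in> unit_sphere b"
  shows "polar_coords b (polar b r \<theta>) = (r, \<theta>)"
  using inv_into_f_f[OF bij_betw_imp_inj_on[OF bij_betw_polar[OF assms(1)]], of "(r, \<theta>)"] assms(2,3)
  by (simp add: polar_coords_def)

lemma polar_coordsE:
  assumes "b \<in> CH" "z \<in> CH - {b}" "polar_coords b z = (r, \<theta>)"
  shows "0 < r" "\<theta> \<in> unit_sphere b" "polar b r \<theta> = z"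
proof -
  have z: "z \<in> (\<lambda>(r, \<theta>). polar b r \<theta>) ` ({0<..} \<times> unit_sphere b)"
    using bij_betw_imp_surj_on[OF bij_betw_polar[OF assms(1)]] assms(2) by simp
  from inv_into_into[OF z] f_inv_into_f[OF z] assms(3)
  show "0 < r" "\<theta> \<in> unit_sphere b" "polar b r \<theta> = z" by (simp_all add: polar_coords_def)
qed

lemma radial_map_polar:
  assumes "b \<in> CH" "0 < r" "\<theta> \<in> unit_sphere b"
  shows "radial_map b t \<phi> (polar b r \<theta>) = polar b (arsinh (exp (t * \<phi> \<theta>) * sinh r)) \<theta>"
proof -
  have "sinh r > 0" using assms by simp
  then show ?thesis
    using assms by (simp add: radial_map_def polar_coords_polar vol_radius_sinh inv_vol_radius Let_def)
qed

lemma one_minus_tanh_square: "1 - (tanh r)\<^sup>2 = 1 / (cosh (r :: real))\<^sup>2"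
proof -
  have "1 - (tanh r)\<^sup>2 = ((cosh r)\<^sup>2 - (sinh r)\<^sup>2) / (cosh r)\<^sup>2"
    by (simp add: tanh_def power_divide diff_divide_distrib)
  then show ?thesis using hyperbolic_pythagoras[of r] by simp
qed

text \<open>
  The expression under the root occurs in the chart; it is the square of the ratio \<open>cosh r' / cosh r\<close> for
  the new radius \<open>r'\<close> with \<open>sinh r' = s sinh r\<close>.
\<close>

lemma cosh_arsinh_ratio:
  "sqrt (1 - (tanh r)\<^sup>2 + s\<^sup>2 * (tanh r)\<^sup>2) = cosh (arsinh (s * sinh r)) / cosh (r :: real)"
proof -
  have "1 - (tanh r)\<^sup>2 + s\<^sup>2 * (tanh r)\<^sup>2 = ((s * sinh r)\<^sup>2 + 1) / (cosh r)\<^sup>2"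
    unfolding one_minus_tanh_square by (simp add: tanh_def power_divide power_mult_distrib add_divide_distrib)
  then show ?thesis by (simp add: cosh_arsinh_real real_sqrt_divide)
qed

text \<open>
  In the chart the radial map is multiplication by this factor: with \<open>q = tanh\<^sup>2 r\<close> and \<open>s = exp p\<close> it is
  \<open>tanh r' / tanh r\<close>.
\<close>

definition radial_factor :: "complex ^ 'm \<Rightarrow> real \<Rightarrow> (complex ^ 'm \<Rightarrow> real) \<Rightarrow> complex ^ 'm \<Rightarrow> real" where
  "radial_factor b t \<phi> y =
     (let q = chg b y y; p = t * \<phi> ((1 / sqrt q) *\<^sub>R y)
      in exp p / sqrt (1 - q + (exp p)\<^sup>2 * q))"

lemma ball_polar:
  assumes b: "b \<in> CH" and y: "y \<noteq> 0" "chg b y y < 1"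
  obtains r \<theta> where "0 < r" "\<theta> \<in> unit_sphere b" "y = tanh r *\<^sub>R \<theta>"
proof -
  define q where "q = sqrt (chg b y y)"
  have q: "0 < q" "q < 1" using chg_pos[OF b y(1)] y(2) by (simp_all add: q_def)
  have "1 < (1 + q) / (1 - q)" using q by (simp add: less_divide_eq)
  then have "0 < artanh q" by (simp add: artanh_def)
  moreover have "(1 / q) *\<^sub>R y \<in> unit_sphere b"
    using chg_pos[OF b y(1)] by (simp add: unit_sphere_def chg_scaleR power_divide q_def)
  moreover have "y = tanh (artanh q) *\<^sub>R ((1 / q) *\<^sub>R y)"
    using q by (simp add: tanh_artanh_real)
  ultimately show thesis by (rule that)
qed

lemma radial_factor_polar:
  assumes r: "0 < r" and \<theta>: "\<theta> \<in> unit_sphere b"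
  shows "radial_factor b t \<phi> (tanh r *\<^sub>R \<theta>) * tanh r = tanh (arsinh (exp (t * \<phi> \<theta>) * sinh r))"
proof -
  have "chg b (tanh r *\<^sub>R \<theta>) (tanh r *\<^sub>R \<theta>) = (tanh r)\<^sup>2" "(1 / tanh r) *\<^sub>R (tanh r *\<^sub>R \<theta>) = \<theta>"
    using \<theta> r by (simp_all add: chg_scaleR unit_sphere_def)
  moreover have "sqrt ((tanh r)\<^sup>2) = tanh r" using r by simp
  ultimately have "radial_factor b t \<phi> (tanh r *\<^sub>R \<theta>) =
      exp (t * \<phi> \<theta>) * cosh r / cosh (arsinh (exp (t * \<phi> \<theta>) * sinh r))"
    by (simp only: radial_factor_def Let_def cosh_arsinh_ratio) simp
  then show ?thesis by (simp add: tanh_def)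
qed

lemma radial_map_proj_map:
  assumes b: "b \<in> CH" and y: "y \<noteq> 0" "chg b y y < 1"
  shows "radial_map b t \<phi> (proj_map b y) = proj_map b (radial_factor b t \<phi> y *\<^sub>R y)"
proof -
  obtain r \<theta> where r: "0 < r" "\<theta> \<in> unit_sphere b" and yr: "y = tanh r *\<^sub>R \<theta>"
    using ball_polar[OF b y] .
  show ?thesis
    using radial_map_polar[OF b r, of t \<phi>] radial_factor_polar[OF r, of t \<phi>]
    by (simp add: polar_eq_proj_map yr)
qed

lemma dilation_has_derivative:
  fixes E q :: "'a::real_normed_vector \<Rightarrow> real"
  assumes E: "(E has_derivative E') (at y)" and q: "(q has_derivative q') (at y)"
    and W: "W = 1 - q y + (E y)\<^sup>2 * q y" "W > 0"
  shows "((\<lambda>y. E y / sqrt (1 - q y + (E y)\<^sup>2 * q y)) has_derivative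
    (\<lambda>a. (2 * (1 - q y) * E' a - E y * ((E y)\<^sup>2 - 1) * q' a) / (2 * sqrt W ^ 3))) (at y)"
proof -
  define W' where "W' a = - q' a + (2 * E y * E' a * q y + (E y)\<^sup>2 * q' a)" for a
  have WW: "sqrt W * sqrt W = W" "sqrt W > 0" using W(2) by simp_all
  have "((\<lambda>y. 1 - q y + E y * E y * q y) has_derivative
      (\<lambda>a. 0 - q' a + (E y * E y * q' a + (E y * E' a + E' a * E y) * q y))) (at y)"
    by (rule has_derivative_add[OF has_derivative_diff[OF has_derivative_const q]
          has_derivative_mult[OF has_derivative_mult[OF E E] q]])
  moreover have "(\<lambda>a. 0 - q' a + (E y * E y * q' a + (E y * E' a + E' a * E y) * q y)) = W'"
    by (rule ext) (simp add: W'_def power2_eq_square distrib_right)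
  ultimately have W'': "((\<lambda>y. 1 - q y + (E y)\<^sup>2 * q y) has_derivative W') (at y)"
    by (simp only: power2_eq_square)
  have "((\<lambda>y. sqrt (1 - q y + (E y)\<^sup>2 * q y)) has_derivative (\<lambda>a. W' a * (inverse (sqrt W) / 2))) (at y)"
    using DERIV_compose_FDERIV[OF DERIV_real_sqrt W''] W by simp
  from has_derivative_divide'[OF E this]
  have "((\<lambda>y. E y / sqrt (1 - q y + (E y)\<^sup>2 * q y)) has_derivative
      (\<lambda>a. (E' a * sqrt W - E y * (W' a * (inverse (sqrt W) / 2))) / (sqrt W * sqrt W))) (at y)"
    using W by simp
  moreover have "(E' a * sqrt W - E y * (W' a * (inverse (sqrt W) / 2))) / (sqrt W * sqrt W)
    = (2 * (1 - q y) * E' a - E y * ((E y)\<^sup>2 - 1) * q' a) / (2 * sqrt W ^ 3)" for a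
  proof -
    have "(e1 * R - e * (w * (inverse R / 2))) / (R * R) = (2 * (R * R) * e1 - e * w) / (2 * R ^ 3)"
      if "R > 0" for e1 e w R :: real
      using that by (simp add: field_simps power3_eq_cube)
    note this[OF WW(2)]
    moreover have "2 * W * E' a - E y * W' a = 2 * (1 - q y) * E' a - E y * ((E y)\<^sup>2 - 1) * q' a"
      unfolding W'_def W(1) by (simp add: algebra_simps power2_eq_square)
    ultimately show ?thesis by (simp only: WW(1))
  qed
  ultimately show ?thesis by simp
qed

text \<open>
  The argument of \<open>\<phi>'\<close> is the derivative of the normalisation \<open>y \<mapsto> y / |y|\<close>: the component of \<open>a\<close>
  orthogonal to \<open>y\<close>, divided by \<open>|y|\<close>.
\<close>

lemma radial_factor_has_derivative:
  fixes b y :: "complex ^ 'm"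
  assumes b: "b \<in> CH" and y: "y \<noteq> 0" "chg b y y < 1"
    and \<phi>: "(\<phi> has_derivative \<phi>') (at ((1 / sqrt (chg b y y)) *\<^sub>R y))"
    and s: "s = exp (t * \<phi> ((1 / sqrt (chg b y y)) *\<^sub>R y))"
    and W: "W = 1 - chg b y y + s\<^sup>2 * chg b y y"
  shows "(radial_factor b t \<phi> has_derivative
    (\<lambda>a. ((1 - chg b y y) * s * t * \<phi>' ((1 / sqrt (chg b y y)) *\<^sub>R (a - (chg b y a / chg b y y) *\<^sub>R y))
       - s * (s\<^sup>2 - 1) * chg b y a) / sqrt W ^ 3)) (at y)"
proof -
  define q where "q = chg b y y"
  have q: "q > 0" using chg_pos[OF b y(1)] by (simp add: q_def)
  have "W > 0" using y(2) q unfolding W q_def[symmetric] s by (simp add: add_pos_pos)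
  have "((\<lambda>x. 1 / sqrt x) has_real_derivative - (1 / (2 * q * sqrt q))) (at q)"
    using q by (auto intro!: derivative_eq_intros simp: field_simps)
  from DERIV_compose_FDERIV[OF this[unfolded q_def] chg_has_derivative]
  have "((\<lambda>y. 1 / sqrt (chg b y y)) has_derivative (\<lambda>a. 2 * chg b y a * - (1 / (2 * q * sqrt q)))) (at y)"
    by (simp add: q_def)
  from has_derivative_scaleR[OF this has_derivative_ident]
  have "((\<lambda>y. (1 / sqrt (chg b y y)) *\<^sub>R y) has_derivative
     (\<lambda>a. (1 / sqrt q) *\<^sub>R (a - (chg b y a / q) *\<^sub>R y))) (at y)"
    by (rule has_derivative_eq_rhs) (simp add: fun_eq_iff q_def algebra_simps)
  from has_derivative_compose[OF this \<phi>]
  have "((\<lambda>y. t * \<phi> ((1 / sqrt (chg b y y)) *\<^sub>R y)) has_derivative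
     (\<lambda>a. t * \<phi>' ((1 / sqrt q) *\<^sub>R (a - (chg b y a / q) *\<^sub>R y)))) (at y)"
    by (rule has_derivative_mult_right)
  from DERIV_compose_FDERIV[OF DERIV_exp this]
  have E: "((\<lambda>y. exp (t * \<phi> ((1 / sqrt (chg b y y)) *\<^sub>R y))) has_derivative
     (\<lambda>a. t * \<phi>' ((1 / sqrt q) *\<^sub>R (a - (chg b y a / q) *\<^sub>R y)) * s)) (at y)"
    by (simp only: s)
  from dilation_has_derivative[OF this chg_has_derivative W[unfolded s] \<open>W > 0\<close>]
  have "(radial_factor b t \<phi> has_derivative
     (\<lambda>a. (2 * (1 - q) * (t * \<phi>' ((1 / sqrt q) *\<^sub>R (a - (chg b y a / q) *\<^sub>R y)) * s)
        - s * (s\<^sup>2 - 1) * (2 * chg b y a)) / (2 * sqrt W ^ 3))) (at y)"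
    unfolding radial_factor_def[abs_def] Let_def by (simp only: s q_def)
  moreover have "(2 * u * (t * f * s) - s * k * (2 * c)) / (2 * d) = (u * s * t * f - s * k * c) / d"
    for u f k c d :: real
    by (cases "d = 0") (simp_all add: field_simps)
  ultimately show ?thesis unfolding q_def[symmetric] by (simp only:)
qed

lemma radial_map_has_derivative:
  fixes b y :: "complex ^ 'm"
  assumes b: "b \<in> CH" and y: "y \<noteq> 0" "chg b y y < 1"
    and \<kappa>: "(radial_factor b t \<phi> has_derivative \<kappa>') (at y)"
    and y': "y' = radial_factor b t \<phi> y *\<^sub>R y" "chg b y' y' < 1"
    and I: "(proj_inv b has_derivative I) (at (proj_map b y))"
  shows "(radial_map b t \<phi> has_derivative
     (\<lambda>x. proj_diff b y' (radial_factor b t \<phi> y *\<^sub>R I x + \<kappa>' (I x) *\<^sub>R y))) (at (proj_map b y))"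
proof -
  have inv: "proj_inv b (proj_map b y) = y"
    using y(2) by (simp add: proj_inv_proj_map proj_den_nonzero[OF b])
  have "((\<lambda>y. radial_factor b t \<phi> y *\<^sub>R y) has_derivative (\<lambda>a. radial_factor b t \<phi> y *\<^sub>R a + \<kappa>' a *\<^sub>R y)) (at y)"
    by (rule has_derivative_scaleR[OF \<kappa> has_derivative_ident])
  from has_derivative_compose[OF this, of "proj_map b" "proj_diff b y'"]
  have "((\<lambda>y. proj_map b (radial_factor b t \<phi> y *\<^sub>R y)) has_derivative
      (\<lambda>a. proj_diff b y' (radial_factor b t \<phi> y *\<^sub>R a + \<kappa>' a *\<^sub>R y))) (at y)"
    using proj_map_has_derivative[OF proj_den_nonzero[OF b y'(2)]] by (simp add: y'(1))
  from has_derivative_compose[OF I, unfolded inv, OF this]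
  have comp: "((\<lambda>z. proj_map b (radial_factor b t \<phi> (proj_inv b z) *\<^sub>R proj_inv b z)) has_derivative
     (\<lambda>x. proj_diff b y' (radial_factor b t \<phi> y *\<^sub>R I x + \<kappa>' (I x) *\<^sub>R y))) (at (proj_map b y))" .
  have bij: "bij_betw (proj_map b) {y. chg b y y < 1} CH" by (rule bij_betw_proj_map[OF b])
  have op: "open (CH - {b})" by (simp add: CH_def open_Diff)
  have mem: "proj_map b y \<in> CH - {b}"
  proof -
    have "proj_map b y \<in> CH" using bij y(2) by (auto simp: bij_betw_def)
    moreover have "proj_map b y \<noteq> proj_map b 0"
      using bij_betw_imp_inj_on[OF bij] y by (auto dest!: inj_onD simp: chg_simps)
    ultimately show ?thesis by (simp add: proj_map_0)
  qed
  have eq: "proj_map b (radial_factor b t \<phi> (proj_inv b z) *\<^sub>R proj_inv b z) = radial_map b t \<phi> z"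
    if "z \<in> CH - {b}" for z
  proof -
    have "z \<in> proj_map b ` {y. chg b y y < 1}"
      using bij_betw_imp_surj_on[OF bij] that by simp
    then obtain u where u: "chg b u u < 1" "z = proj_map b u" by auto
    have "u \<noteq> 0" using that u by (auto simp: proj_map_0)
    then show ?thesis
      using u radial_map_proj_map[OF b, of u t \<phi>] by (simp add: proj_inv_proj_map proj_den_nonzero[OF b])
  qed
  show ?thesis by (rule has_derivative_transform_within_open[OF comp op mem eq])
qed

section \<open>The differential of the radial maps\<close>

text \<open>
  Both sides are the Gram determinant of the Bergman metric pulled back by \<open>proj_map b\<close>, which is
  the metric of a unit ball for the Hermitian form \<open>bergman b\<close>.
\<close>

lemma gram_det_pull_back:
  fixes b y :: "complex ^ 'm"
  assumes b: "b \<in> CH" and y: "chg b y y < 1"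
  shows "(real_det (proj_diff b y))\<^sup>2 * gram_det (proj_map b y) =
    gram_det b / (1 - chg b y y) ^ (2 * CARD('m) + 2)"
proof -
  have gram: "gram_det z = gram_form (chg z)" for z :: "complex ^ 'm"
    by (simp add: gram_det_def gram_form_def)
  have lin: "linear (proj_diff b y)"
    using proj_map_has_derivative[OF proj_den_nonzero[OF b y]] by (rule has_derivative_linear)
  have byy: "bergman b y y = of_real (chg b y y)" by (rule bergman_self(1)[OF b])
  then have ne: "bergman b y y \<noteq> 1" using y by (metis less_irrefl of_real_eq_1_iff)
  let ?z = "proj_map b y"
  have "gram_form (\<lambda>u v. chg ?z (proj_diff b y u) (proj_diff b y v))
      = gram_form (\<lambda>u v. chg ?z (proj_diff b y u) v) * real_det (proj_diff b y)"
    by (rule gram_form_right_compose) (simp add: linear_iff chg_simps)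
  also have "gram_form (\<lambda>u v. chg ?z (proj_diff b y u) v) = real_det (proj_diff b y) * gram_form (chg ?z)"
    by (rule gram_form_left_compose) (simp add: linear_iff chg_simps)
  finally have "(real_det (proj_diff b y))\<^sup>2 * gram_det ?z =
      gram_form (\<lambda>u v. chg ?z (proj_diff b y u) (proj_diff b y v))"
    by (simp add: gram power2_eq_square)
  also have "\<dots> = gram_form (\<lambda>u v. Re (((1 - of_real (chg b y y)) * bergman b u v + bergman b u y * bergman b y v)
      / (1 - of_real (chg b y y))\<^sup>2))"
    unfolding chg_def[of ?z] bergman_proj_map[OF b proj_den_nonzero[OF b y] ne] byy ..
  also have "\<dots> = gram_form (\<lambda>u v. Re (bergman b u v)) / (1 - chg b y y) ^ (2 * CARD('m) + 2)"
    by (rule gram_form_hermitian_update[where H = "bergman b" and y = y and \<rho> = "chg b y y"])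
       (use y byy in \<open>simp_all add: bergman_simps cnj_bergman\<close>)
  finally show ?thesis by (simp add: gram chg_def[abs_def])
qed

lemma polar_diff_eq:
  assumes "b \<in> CH" "\<theta> \<in> unit_sphere b"
  shows "polar_diff b r \<theta> (\<xi>, X) =
    proj_diff b (tanh r *\<^sub>R \<theta>) ((\<xi> / (cosh r)\<^sup>2) *\<^sub>R \<theta> + tanh r *\<^sub>R X)"
  unfolding polar_diff_def frechet_derivative_at[OF polar_has_derivative(1)[OF assms], symmetric]
  by (simp add: one_minus_tanh_square)

text \<open>
  In the chart, with \<open>y = tanh r \<theta>\<close>, the differential is \<open>G a = \<kappa> a + \<kappa>'(a) y\<close>. Evaluating it on the
  chart expression of \<open>polar_diff\<close> gives the triangular form. The factor \<open>s\<^sup>n\<close> is the volume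
  distortion: \<open>F\<close> multiplies the volume radius by \<open>s\<close> along each ray. It results from
  \<open>det G = \<kappa>\<^sup>n (1 + \<kappa>'(y) / \<kappa>) = s\<^sup>n / W\<^sup>n\<^sup>/\<^sup>2\<^sup>+\<^sup>1\<close> and from the densities of the metric in the chart at the
  two points, whose ratio is \<open>W\<^sup>n\<^sup>/\<^sup>2\<^sup>+\<^sup>1\<close>, where \<open>W = cosh\<^sup>2 r' / cosh\<^sup>2 r\<close>.
\<close>

lemma radial_map_differential:
  fixes b \<theta> :: "complex ^ 'm" and L :: "complex ^ 'm \<Rightarrow> complex ^ 'm"
  assumes b: "b \<in> CH" and \<theta>: "\<theta> \<in> unit_sphere b" and r: "0 < r"
    and \<phi>: "(\<phi> has_derivative \<phi>') (at \<theta>)"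
    and s: "s = exp (t * \<phi> \<theta>)" and r': "r' = arsinh (s * sinh r)"
    and L: "L = frechet_derivative (radial_map b t \<phi>) (at (polar b r \<theta>))"
  shows "linear L"
    and "\<And>\<xi> X. chg b X \<theta> = 0 \<Longrightarrow> L (polar_diff b r \<theta> (\<xi>, X)) =
       polar_diff b r' \<theta> (s * cosh r / cosh r' * \<xi> + s * sinh r / cosh r' * t * \<phi>' X, X)"
    and "(metric_det (polar b r \<theta>) (polar b r' \<theta>) L)\<^sup>2 = (s ^ (2 * CARD('m)))\<^sup>2"
proof -
  define \<tau> where "\<tau> = tanh r"
  define y where "y = \<tau> *\<^sub>R \<theta>"
  define y' where "y' = tanh r' *\<^sub>R \<theta>"
  define \<kappa> where "\<kappa> = radial_factor b t \<phi> y"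
  define W where "W = 1 - \<tau>\<^sup>2 + s\<^sup>2 * \<tau>\<^sup>2"
  have th: "chg b \<theta> \<theta> = 1" using \<theta> by (simp add: unit_sphere_def)
  have spos: "s > 0" by (simp add: s)
  have \<tau>: "0 < \<tau>" "\<tau>\<^sup>2 < 1" using r tanh_square_less_1[OF b \<theta>] by (simp_all add: \<tau>_def)
  have q: "chg b y y = \<tau>\<^sup>2" by (simp add: y_def chg_scaleR th)
  have q': "chg b y' y' = (tanh r')\<^sup>2" by (simp add: y'_def chg_scaleR th)
  have y1: "chg b y y < 1" "chg b y' y' < 1" using \<tau> tanh_square_less_1[OF b \<theta>] by (simp_all add: q q')
  have y0: "y \<noteq> 0" using q \<tau> by (auto simp: chg_simps)
  have dir: "(1 / sqrt (chg b y y)) *\<^sub>R y = \<theta>" using \<tau> unfolding q by (simp add: y_def)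
  have Wpos: "W > 0" using \<tau> spos by (simp add: W_def add_pos_pos)
  have sqW: "sqrt W = cosh r' / cosh r" unfolding W_def \<tau>_def r' by (rule cosh_arsinh_ratio)
  have \<kappa>s: "\<kappa> = s / sqrt W" unfolding \<kappa>_def radial_factor_def Let_def dir unfolding q W_def s ..
  have ky: "y' = \<kappa> *\<^sub>R y"
    unfolding y'_def y_def \<kappa>_def \<tau>_def r' s using radial_factor_polar[OF r \<theta>, of t \<phi>] by simp
  define \<kappa>' where "\<kappa>' a = ((1 - \<tau>\<^sup>2) * s * t * \<phi>' ((1 / \<tau>) *\<^sub>R (a - (chg b y a / \<tau>\<^sup>2) *\<^sub>R y))
       - s * (s\<^sup>2 - 1) * chg b y a) / sqrt W ^ 3" for a
  have \<kappa>': "(radial_factor b t \<phi> has_derivative \<kappa>') (at y)"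
  proof -
    have "sqrt (\<tau>\<^sup>2) = \<tau>" using \<tau> by simp
    then show ?thesis
      using radial_factor_has_derivative[OF b y0 y1(1), of \<phi> \<phi>' s t W] \<phi> s
      unfolding dir by (simp add: q W_def \<kappa>'_def[abs_def])
  qed
  obtain I where I: "(proj_inv b has_derivative I) (at (proj_map b y))"
    "\<And>a. I (proj_diff b y a) = a" "\<And>a. proj_diff b y (I a) = a"
    using proj_map_chart[OF b y1(1)] by metis
  define G where "G a = \<kappa> *\<^sub>R a + \<kappa>' a *\<^sub>R y" for a
  have pz: "polar b r \<theta> = proj_map b y" "polar b r' \<theta> = proj_map b y'"
    by (simp_all add: polar_eq_proj_map y_def y'_def \<tau>_def)
  have deriv: "(radial_map b t \<phi> has_derivative (\<lambda>x. proj_diff b y' (G (I x)))) (at (polar b r \<theta>))"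
    unfolding pz G_def \<kappa>_def
    by (rule radial_map_has_derivative[OF b y0 y1(1) \<kappa>' _ y1(2) I(1)]) (simp add: ky \<kappa>_def)
  have Leq: "L = (\<lambda>x. proj_diff b y' (G (I x)))"
    unfolding L by (rule frechet_derivative_at[OF deriv, symmetric])
  show linL: "linear L" unfolding Leq by (rule has_derivative_linear[OF deriv])
  have lin: "linear (proj_diff b y)" "linear (proj_diff b y')"
    using proj_map_has_derivative[OF proj_den_nonzero[OF b]] y1 by (auto intro: has_derivative_linear)
  have lin\<phi>: "linear \<phi>'" by (rule has_derivative_linear[OF \<phi>])
  have C: "cosh r > 0" "cosh r' > 0" by (simp_all add: cosh_real_pos)
  have C2: "(cosh r)\<^sup>2 = 1 + (sinh r)\<^sup>2" "(cosh r')\<^sup>2 = 1 + s\<^sup>2 * (sinh r)\<^sup>2"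
    unfolding r' using cosh_square_eq[of r] by (simp_all add: cosh_arsinh_real power_mult_distrib)
  show "L (polar_diff b r \<theta> (\<xi>, X)) =
       polar_diff b r' \<theta> (s * cosh r / cosh r' * \<xi> + s * sinh r / cosh r' * t * \<phi>' X, X)"
    if X: "chg b X \<theta> = 0" for \<xi> X
  proof -
    define a where "a = (\<xi> / (cosh r)\<^sup>2) *\<^sub>R \<theta> + \<tau> *\<^sub>R X"
    have ya: "chg b y a = \<tau> * \<xi> / (cosh r)\<^sup>2"
      by (simp add: y_def a_def chg_simps th chg_commute[of b \<theta> X] X)
    have aX: "(1 / \<tau>) *\<^sub>R (a - (chg b y a / \<tau>\<^sup>2) *\<^sub>R y) = X"
      using \<tau> unfolding ya by (simp add: a_def y_def power2_eq_square)
    have "L (polar_diff b r \<theta> (\<xi>, X)) = proj_diff b y' (G a)"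
      unfolding Leq polar_diff_eq[OF b \<theta>] a_def y_def[symmetric] \<tau>_def[symmetric] I(2) ..
    also have "G a = ((s * cosh r / cosh r' * \<xi> + s * sinh r / cosh r' * t * \<phi>' X) / (cosh r')\<^sup>2) *\<^sub>R \<theta> + tanh r' *\<^sub>R X"
    proof -
      have "G a = (\<kappa> * \<xi> / (cosh r)\<^sup>2 + \<kappa>' a * \<tau>) *\<^sub>R \<theta> + (\<kappa> * \<tau>) *\<^sub>R X"
        by (simp add: G_def a_def[symmetric]) (simp add: a_def y_def algebra_simps)
      moreover have "\<kappa> * \<tau> = tanh r'"
        unfolding \<kappa>s sqW \<tau>_def tanh_def using C by (simp add: r')
      moreover have "\<kappa> * \<xi> / (cosh r)\<^sup>2 + \<kappa>' a * \<tau> =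
          (s * cosh r / cosh r' * \<xi> + s * sinh r / cosh r' * t * \<phi>' X) / (cosh r')\<^sup>2"
      proof -
        have k': "\<kappa>' a = (1 / (cosh r)\<^sup>2 * s * t * \<phi>' X - s * (s\<^sup>2 - 1) * (\<tau> * \<xi> / (cosh r)\<^sup>2)) / sqrt W ^ 3"
          unfolding \<kappa>'_def aX unfolding ya by (simp add: \<tau>_def one_minus_tanh_square)
        have alg: "s / (D / c) * \<xi> / c\<^sup>2 + (1 / c\<^sup>2 * s * t * f - s * (s\<^sup>2 - 1) * (S / c * \<xi> / c\<^sup>2)) / (D / c) ^ 3 * (S / c)
           = (s * c / D * \<xi> + s * S / D * t * f) / D\<^sup>2"
          if "c > 0" "D > 0" "c\<^sup>2 = 1 + S\<^sup>2" "D\<^sup>2 = 1 + s\<^sup>2 * S\<^sup>2" for c D S f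
        proof -
          have "s * \<xi> / (D * c) - s * (s\<^sup>2 - 1) * S\<^sup>2 * \<xi> / (c * D ^ 3) = s * c * \<xi> / D ^ 3"
          proof -
            have "D\<^sup>2 - (s\<^sup>2 - 1) * S\<^sup>2 = c\<^sup>2" using that by (simp add: algebra_simps)
            moreover have "s * \<xi> / (D * c) - s * (s\<^sup>2 - 1) * S\<^sup>2 * \<xi> / (c * D ^ 3)
                = s * \<xi> * (D\<^sup>2 - (s\<^sup>2 - 1) * S\<^sup>2) / (c * D ^ 3)"
              using that(1,2) by (simp add: field_simps power3_eq_cube power2_eq_square)
            ultimately show ?thesis using that(1) by (simp add: power2_eq_square)
          qed
          then show ?thesis using that(1,2)
            by (simp add: divide_simps power3_eq_cube power2_eq_square) (simp add: algebra_simps)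
        qed
        show ?thesis
          unfolding k' \<kappa>s sqW by (unfold \<tau>_def tanh_def, rule alg[OF C C2])
      qed
      ultimately show ?thesis by (simp only:)
    qed
    finally show ?thesis unfolding polar_diff_eq[OF b \<theta>] y'_def .
  qed
  let ?N = "2 * CARD('m) + 2"
  have zCH: "proj_map b y \<in> CH" "proj_map b y' \<in> CH"
    using bij_betw_imp_surj_on[OF bij_betw_proj_map[OF b]] y1 by auto
  have "real_det L * real_det (proj_diff b y) = real_det (\<lambda>a. L (proj_diff b y a))"
    by (rule real_det_compose[OF linL, symmetric])
  also have "(\<lambda>a. L (proj_diff b y a)) = (\<lambda>a. proj_diff b y' (G a))" by (simp add: Leq I(2))
  also have "real_det \<dots> = real_det (proj_diff b y') * real_det G" by (rule real_det_compose[OF lin(2)])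
  finally have mult: "real_det L * real_det (proj_diff b y) = real_det (proj_diff b y') * real_det G" .
  \<comment> \<open>\<open>G\<close> is a rank-one update of \<open>\<kappa>\<close> times the identity.\<close>
  have G2: "(real_det G)\<^sup>2 * W ^ ?N = (s ^ (2 * CARD('m)))\<^sup>2"
  proof -
    have "real_det G = \<kappa> ^ (2 * CARD('m)) * (1 + \<kappa>' y / \<kappa>)"
      unfolding G_def using spos Wpos
      by (intro real_det_scaled_rank_one has_derivative_linear[OF \<kappa>']) (simp add: \<kappa>s)
    also have "1 + \<kappa>' y / \<kappa> = 1 / W"
    proof -
      have "\<kappa>' y = - (s * (s\<^sup>2 - 1) * \<tau>\<^sup>2) / sqrt W ^ 3"
        using \<tau> by (simp add: \<kappa>'_def q linear_0[OF lin\<phi>])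
      then have "\<kappa>' y / \<kappa> = - ((s\<^sup>2 - 1) * \<tau>\<^sup>2) / (sqrt W * sqrt W)"
        using spos Wpos by (simp add: \<kappa>s power3_eq_cube field_simps)
      then have "1 + \<kappa>' y / \<kappa> = (W - (s\<^sup>2 - 1) * \<tau>\<^sup>2) / W" using Wpos by (simp add: diff_divide_distrib)
      also have "W - (s\<^sup>2 - 1) * \<tau>\<^sup>2 = 1" by (simp add: W_def algebra_simps)
      finally show ?thesis .
    qed
    finally have "(real_det G)\<^sup>2 = (\<kappa>\<^sup>2) ^ (2 * CARD('m)) / W\<^sup>2"
      by (simp add: power_divide power_mult_distrib mult.commute flip: power_mult)
    moreover have "\<kappa>\<^sup>2 = s\<^sup>2 / W" using Wpos by (simp add: \<kappa>s power_divide)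
    ultimately have "(real_det G)\<^sup>2 = (s\<^sup>2) ^ (2 * CARD('m)) / W ^ (2 * CARD('m)) / W\<^sup>2"
      by (simp only: power_divide)
    then have "(real_det G)\<^sup>2 * W ^ ?N = (s\<^sup>2) ^ (2 * CARD('m))"
      using Wpos unfolding power_add by (simp only:) simp
    then show ?thesis by (simp only: power_mult[symmetric] mult.commute)
  qed
  define g where "g = gram_det b"
  have gpos: "g > 0" unfolding g_def by (rule gram_det_pos[OF b])
  have q1: "1 - chg b y' y' = (1 - \<tau>\<^sup>2) / W"
  proof -
    have "W = (cosh r' / cosh r)\<^sup>2" using Wpos unfolding sqW[symmetric] by simp
    then show ?thesis using C unfolding q' \<tau>_def one_minus_tanh_square by (simp add: power_divide)
  qed
  have P1: "(real_det (proj_diff b y))\<^sup>2 * gram_det (proj_map b y) = g / (1 - \<tau>\<^sup>2) ^ ?N"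
    using gram_det_pull_back[OF b y1(1)] by (simp only: q g_def)
  have P2: "(real_det (proj_diff b y'))\<^sup>2 * gram_det (proj_map b y') = g * W ^ ?N / (1 - \<tau>\<^sup>2) ^ ?N"
    using gram_det_pull_back[OF b y1(2)] unfolding q1 by (simp add: power_divide g_def)
  \<comment> \<open>The chain rule \<open>L dP\<^sub>y = dP\<^sub>y\<^sub>' G\<close> combined with the two densities; the common factor \<open>d\<^sup>2\<close> cancels.\<close>
  define d where "d = real_det (proj_diff b y)"
  define l where "l = real_det L"
  have pos: "g / (1 - \<tau>\<^sup>2) ^ ?N > 0" using gpos \<tau> by simp
  have "l\<^sup>2 * gram_det (proj_map b y') * d\<^sup>2 = (l * d)\<^sup>2 * gram_det (proj_map b y')"
    by (simp add: power_mult_distrib)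
  also have "\<dots> = (real_det G)\<^sup>2 * ((real_det (proj_diff b y'))\<^sup>2 * gram_det (proj_map b y'))"
    unfolding l_def d_def mult by (simp add: power_mult_distrib)
  also have "\<dots> = ((real_det G)\<^sup>2 * W ^ ?N) * (g / (1 - \<tau>\<^sup>2) ^ ?N)" unfolding P2 by simp
  also have "\<dots> = (s ^ (2 * CARD('m)))\<^sup>2 * gram_det (proj_map b y) * d\<^sup>2"
    unfolding G2 P1[symmetric] d_def by simp
  finally have "l\<^sup>2 * gram_det (proj_map b y') = (s ^ (2 * CARD('m)))\<^sup>2 * gram_det (proj_map b y)"
    using pos unfolding P1[symmetric] d_def by auto
  then show "(metric_det (polar b r \<theta>) (polar b r' \<theta>) L)\<^sup>2 = (s ^ (2 * CARD('m)))\<^sup>2"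
    using gram_det_pos[OF zCH(1)] unfolding pz metric_det_square[OF zCH] l_def by simp
qed

section \<open>Adjoints and cofactors\<close>

lemma chg_riesz:
  fixes z :: "complex ^ 'm"
  assumes z: "z \<in> CH" and l: "linear l"
  shows "\<exists>u. \<forall>x. chg z x u = l x"
proof -
  define s where "s = 1 - (norm z)\<^sup>2"
  \<comment> \<open>The matrix of the metric with respect to the Euclidean inner product.\<close>
  define A where "A u = (1 / s) *\<^sub>R u + (1 / s\<^sup>2) *\<^sub>R (hprod u z *s z)" for u :: "complex ^ 'm"
  have s: "s > 0" using z by (simp add: s_def CH_iff)
  have A: "x \<bullet> A u = chg z x u" for x u
  proof -
    have "chg z x u = (s * Re (hprod x u) + Re (hprod x z * hprod z u)) / s\<^sup>2"
      unfolding chg_def bergman_def s_def[symmetric] Re_divide_of_real by simp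
    also have "\<dots> = Re (hprod x u) / s + Re (hprod x z * hprod z u) / s\<^sup>2"
      using s by (simp add: add_divide_distrib power2_eq_square)
    finally show ?thesis
      by (simp add: A_def inner_add_right inner_hprod hprod_simps cnj_hprod mult.commute)
  qed
  have linA: "linear A"
    by (simp add: linear_iff A_def hprod_simps scaleR_add_right vec_eq_iff
        scaleR_conv_of_real[where 'a = complex] algebra_simps)
  have "inj A"
  proof (rule linear_injective_0[OF linA, THEN iffD2], intro allI impI)
    fix u assume "A u = 0"
    then have "chg z u u = 0" by (simp flip: A)
    then show "u = 0" using chg_pos[OF z, of u] by fastforce
  qed
  then have "surj A" by (rule linear_injective_imp_surjective[OF linA _ refl])
  then obtain u where "A u = adjoint l 1" by (metis surjD)
  then have "chg z x u = l x" for x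
    using adjoint_works[OF l, of x 1] by (simp flip: A)
  then show ?thesis by blast
qed

lemma chg_nondegenerate:
  assumes z: "z \<in> CH" and "\<And>x. chg z x u = chg z x u'"
  shows "u = u'"
proof -
  have "chg z (u - u') (u - u') = 0" using assms(2)[of "u - u'"] by (simp add: chg_simps)
  then show ?thesis using chg_pos[OF z, of "u - u'"] by fastforce
qed

text \<open>
  Instead of inverting the adjoint one exhibits a vector \<open>c\<close> with the defining property of the
  preimage of \<open>\<nu>\<close>; nondegeneracy of the image of \<open>L\<close> makes the adjoint injective.
\<close>

lemma inv_metric_adj:
  fixes z w :: "complex ^ 'm"
  assumes z: "z \<in> CH" and L: "linear L"
    and nondeg: "\<And>d. (\<And>x. chg w (L x) d = 0) \<Longrightarrow> d = 0"
    and c: "\<And>x. chg w (L x) c = chg z x \<nu>"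
  shows "inv (metric_adj z w L) \<nu> = c"
proof -
  have adj: "chg z x (metric_adj z w L v) = chg w (L x) v" for x v
  proof -
    have "linear (\<lambda>x. chg w (L x) v)"
      using L by (simp add: linear_iff chg_simps)
    from chg_riesz[OF z this] obtain u where u: "\<forall>x. chg z x u = chg w (L x) v" ..
    have "\<exists>!u. \<forall>x. chg z x u = chg w (L x) v"
      using u by (intro ex1I[of _ u]) (auto intro: chg_nondegenerate[OF z])
    from theI'[OF this] show ?thesis unfolding metric_adj_def by blast
  qed
  have "inj (metric_adj z w L)"
  proof (rule injI)
    fix u v assume "metric_adj z w L u = metric_adj z w L v"
    then have "chg w (L x) (u - v) = 0" for x
      using adj[of x u] adj[of x v] by (simp add: chg_simps)
    from nondeg[OF this] show "u = v" by simp
  qed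
  moreover have "metric_adj z w L c = \<nu>"
    by (rule chg_nondegenerate[OF z]) (simp add: adj c)
  ultimately show ?thesis by (rule inv_f_eq)
qed

section \<open>Horizontal and vertical vectors\<close>

lemma chg_times_i: "chg b (\<i> *s u) (\<i> *s v) = chg b u v"
  by (simp add: chg_def bergman_simps)

lemma chg_i_self: "chg b (\<i> *s u) u = 0"
  using cnj_bergman[of b u u] by (simp add: chg_def bergman_simps complex_eq_iff)

lemma hor_space_iff: "X \<in> hor_space b \<theta> \<longleftrightarrow> chg b X \<theta> = 0 \<and> chg b X (\<i> *s \<theta>) = 0"
  by (auto simp: hor_space_def vert_space_def span_singleton chg_simps)

lemma vert_space_iff: "Y \<in> vert_space \<theta> \<longleftrightarrow> (\<exists>c. Y = c *\<^sub>R (\<i> *s \<theta>))"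
  by (auto simp: vert_space_def span_singleton)

lemma hor_space_lincomb:
  "X \<in> hor_space b \<theta> \<Longrightarrow> X' \<in> hor_space b \<theta> \<Longrightarrow> c *\<^sub>R X - d *\<^sub>R X' \<in> hor_space b \<theta>"
  by (simp add: hor_space_iff chg_simps)

lemma vert_space_lincomb:
  "Y \<in> vert_space \<theta> \<Longrightarrow> Y' \<in> vert_space \<theta> \<Longrightarrow> c *\<^sub>R Y - d *\<^sub>R Y' \<in> vert_space \<theta>"
  unfolding vert_space_def by (intro span_diff span_scale)

lemma hor_vert_orthogonal:
  "X \<in> hor_space b \<theta> \<Longrightarrow> Y \<in> vert_space \<theta> \<Longrightarrow> chg b X Y = 0"
  by (simp add: hor_space_def)

lemma vert_tangent: "Y \<in> vert_space \<theta> \<Longrightarrow> chg b Y \<theta> = 0"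
  by (auto simp: vert_space_iff chg_simps chg_i_self)

lemma tangent_decomposition:
  assumes \<theta>: "\<theta> \<in> unit_sphere b" and u: "chg b u \<theta> = 0"
  obtains X Y where "X \<in> hor_space b \<theta>" "Y \<in> vert_space \<theta>" "u = X + Y"
    "Y = chg b u (\<i> *s \<theta>) *\<^sub>R (\<i> *s \<theta>)"
proof -
  define Y where "Y = chg b u (\<i> *s \<theta>) *\<^sub>R (\<i> *s \<theta>)"
  have "Y \<in> vert_space \<theta>" by (auto simp: Y_def vert_space_iff)
  moreover have "u - Y \<in> hor_space b \<theta>"
    using \<theta> u by (simp add: Y_def hor_space_iff chg_simps chg_times_i chg_i_self unit_sphere_def)
  ultimately show thesis using that[of "u - Y" Y] by (simp add: Y_def)
qed

lemma polar_diff_linear: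
  assumes "b \<in> CH" "\<theta> \<in> unit_sphere b"
  shows "linear (polar_diff b r \<theta>)"
  unfolding polar_diff_def frechet_derivative_at[OF polar_has_derivative(1)[OF assms], symmetric]
  by (rule has_derivative_linear[OF polar_has_derivative(1)[OF assms]])

lemma polar_diff_surj:
  assumes b: "b \<in> CH" and \<theta>: "\<theta> \<in> unit_sphere b" and r: "0 < r"
  obtains \<xi> X Y where "X \<in> hor_space b \<theta>" "Y \<in> vert_space \<theta>" "x = polar_diff b r \<theta> (\<xi>, X + Y)"
proof -
  have th: "chg b \<theta> \<theta> = 1" using \<theta> by (simp add: unit_sphere_def)
  have "chg b (tanh r *\<^sub>R \<theta>) (tanh r *\<^sub>R \<theta>) < 1"
    using tanh_square_less_1[OF b \<theta>] by (simp add: chg_scaleR th)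
  then obtain a where a: "x = proj_diff b (tanh r *\<^sub>R \<theta>) a"
    using proj_map_chart[OF b] by metis
  define u where "u = (1 / tanh r) *\<^sub>R (a - chg b a \<theta> *\<^sub>R \<theta>)"
  have "chg b u \<theta> = 0" by (simp add: u_def chg_simps th)
  then obtain X Y where XY: "X \<in> hor_space b \<theta>" "Y \<in> vert_space \<theta>" "u = X + Y"
    using tangent_decomposition[OF \<theta>] by metis
  have "x = polar_diff b r \<theta> (chg b a \<theta> * (cosh r)\<^sup>2, X + Y)"
    unfolding polar_diff_eq[OF b \<theta>] a XY(3)[symmetric] using r by (simp add: u_def)
  with XY that show thesis by blast
qed

lemma polar_in_CH:
  assumes "b \<in> CH" "0 < r" "\<theta> \<in> unit_sphere b"
  shows "polar b r \<theta> \<in> CH"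
  using bij_betw_apply[OF bij_betw_polar[OF assms(1)], of "(r, \<theta>)"] assms(2,3) by simp

section \<open>The Jacobian of a hyperplane\<close>

text \<open>
  The vector \<open>c\<close> of the proof is the image of \<open>\<nu>\<close> under the inverse transpose of the differential. Since
  the differential is triangular, \<open>c\<close> is found by back substitution: the radial component is
  \<open>\<alpha>\<close> divided by the factor \<open>s C / C'\<close>, and it feeds the multiple \<open>k\<close> of the gradient \<open>g + h\<close> into the
  components along the sphere, which are then rescaled by the metric coefficients of the two spheres.
\<close>

lemma J_Pi_formula:
  fixes b \<theta> \<nu> X\<^sub>v Y\<^sub>w g h :: "complex ^ 'm"
  assumes b: "b \<in> CH" and \<theta>: "\<theta> \<in> unit_sphere b" and r: "0 < r"
    and \<phi>: "(\<phi> has_derivative \<phi>') (at \<theta>)"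
    and \<nu>: "\<nu> = polar_diff b r \<theta> (\<alpha>, X\<^sub>v + Y\<^sub>w)"
    and X\<^sub>v: "X\<^sub>v \<in> hor_space b \<theta>" and Y\<^sub>w: "Y\<^sub>w \<in> vert_space \<theta>"
    and g: "g \<in> hor_space b \<theta>" and h: "h \<in> vert_space \<theta>"
    and grad: "\<And>X. chg b X \<theta> = 0 \<Longrightarrow> \<phi>' X = chg b X (g + h)"
    and s: "s = exp (t * \<phi> \<theta>)"
  shows "J_Pi b (polar b r \<theta>) \<nu> t \<phi> = sqrt ((s ^ (2 * CARD('m) - 1))\<^sup>2 *
    (\<alpha>\<^sup>2 * (1 + s\<^sup>2 * (sinh r)\<^sup>2) / (cosh r)\<^sup>2
     + ((sinh r)\<^sup>2 * chg b X\<^sub>v X\<^sub>v - 2 * \<alpha> * t * (sinh r / cosh r) * \<phi>' X\<^sub>v + \<alpha>\<^sup>2 * t\<^sup>2 * chg b g g / (cosh r)\<^sup>2)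
     + ((sinh r)\<^sup>2 * (cosh r) ^ 4 * chg b Y\<^sub>w Y\<^sub>w - 2 * \<alpha> * t * (sinh r * cosh r) * \<phi>' Y\<^sub>w + \<alpha>\<^sup>2 * t\<^sup>2 * chg b h h / (cosh r)\<^sup>2)
       / (1 + s\<^sup>2 * (sinh r)\<^sup>2)))"
proof -
  define r' where "r' = arsinh (s * sinh r)"
  define S where "S = sinh r"
  define C where "C = cosh r"
  define C' where "C' = cosh r'"
  define k where "k = \<alpha> * t / (S * C)"
  define z where "z = polar b r \<theta>"
  define w where "w = polar b r' \<theta>"
  define L where "L = frechet_derivative (radial_map b t \<phi>) (at z)"
  have pos: "s > 0" "S > 0" "C > 0" "C' > 0"
    using r by (simp_all add: s S_def C_def C'_def cosh_real_pos)
  have r'0: "0 < r'" using pos by (simp add: r'_def S_def)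
  have S': "sinh r' = s * S" by (simp add: r'_def S_def)
  have C'2: "C'\<^sup>2 = 1 + s\<^sup>2 * S\<^sup>2"
    by (simp add: C'_def r'_def S_def cosh_arsinh_real power_mult_distrib)
  note diff = radial_map_differential[OF b \<theta> r \<phi> s r'_def refl, folded z_def, folded L_def, folded S_def C_def C'_def]
  have zw: "z \<in> CH" "w \<in> CH"
    unfolding z_def w_def using polar_in_CH[OF b _ \<theta>] r r'0 by blast+
  note met = polar_metric[OF b \<theta> r, folded z_def, folded S_def C_def]
  note met' = polar_metric[OF b \<theta> r'0, folded w_def, unfolded S', folded C'_def]
  define c\<^sub>X where "c\<^sub>X = (1 / s\<^sup>2) *\<^sub>R X\<^sub>v - (k / s\<^sup>2) *\<^sub>R g"
  define c\<^sub>Y where "c\<^sub>Y = (C\<^sup>2 / (s\<^sup>2 * C'\<^sup>2)) *\<^sub>R Y\<^sub>w - (k / (s\<^sup>2 * C'\<^sup>2)) *\<^sub>R h"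
  define c where "c = polar_diff b r' \<theta> (\<alpha> * C' / (s * C), c\<^sub>X + c\<^sub>Y)"
  have cXY: "c\<^sub>X \<in> hor_space b \<theta>" "c\<^sub>Y \<in> vert_space \<theta>"
    unfolding c\<^sub>X_def c\<^sub>Y_def by (intro hor_space_lincomb vert_space_lincomb X\<^sub>v Y\<^sub>w g h)+
  have \<phi>'XY: "\<phi>' (X + Y) = chg b X g + chg b Y h"
    if "X \<in> hor_space b \<theta>" "Y \<in> vert_space \<theta>" for X Y
  proof -
    have "chg b (X + Y) \<theta> = 0" using that by (simp add: chg_simps vert_tangent hor_space_iff)
    moreover have "chg b X h = 0" "chg b Y g = 0"
      using hor_vert_orthogonal[OF that(1) h] hor_vert_orthogonal[OF g that(2)] by (simp_all add: chg_commute)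
    ultimately show ?thesis by (simp add: grad chg_simps)
  qed
  have L: "L (polar_diff b r \<theta> (\<xi>, X + Y)) =
       polar_diff b r' \<theta> (s * C / C' * \<xi> + s * S / C' * t * (chg b X g + chg b Y h), X + Y)"
    if "X \<in> hor_space b \<theta>" "Y \<in> vert_space \<theta>" for \<xi> X Y
  proof -
    have "chg b (X + Y) \<theta> = 0" using that by (simp add: chg_simps vert_tangent hor_space_iff)
    from diff(2)[OF this] show ?thesis unfolding \<phi>'XY[OF that] .
  qed
  have adj: "chg w (L x) c = chg z x \<nu>" for x
  proof -
    obtain \<xi> X Y where XY: "X \<in> hor_space b \<theta>" "Y \<in> vert_space \<theta>" and x: "x = polar_diff b r \<theta> (\<xi>, X + Y)"
      by (rule polar_diff_surj[OF b \<theta> r])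
    have "chg w (L x) c = (s * C / C' * \<xi> + s * S / C' * t * (chg b X g + chg b Y h)) * (\<alpha> * C' / (s * C))
       + (s * S)\<^sup>2 * chg b X c\<^sub>X + (s * S)\<^sup>2 * C'\<^sup>2 * chg b Y c\<^sub>Y"
      unfolding x L[OF XY] c_def met'[OF XY(1) cXY(1) XY(2) cXY(2)] ..
    also have "\<dots> = \<xi> * \<alpha> + S\<^sup>2 * chg b X X\<^sub>v + S\<^sup>2 * C\<^sup>2 * chg b Y Y\<^sub>w"
      using pos unfolding c\<^sub>X_def c\<^sub>Y_def chg_simps k_def
      by (simp add: field_simps power2_eq_square)
    also have "\<dots> = chg z x \<nu>" unfolding x \<nu> met[OF XY(1) X\<^sub>v XY(2) Y\<^sub>w] ..
    finally show ?thesis .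
  qed
  have nondeg: "d = 0" if "\<And>x. chg w (L x) d = 0" for d
  proof -
    obtain \<xi> X Y where XY: "X \<in> hor_space b \<theta>" "Y \<in> vert_space \<theta>" and d: "d = polar_diff b r' \<theta> (\<xi>, X + Y)"
      by (rule polar_diff_surj[OF b \<theta> r'0])
    \<comment> \<open>Back substitution for a preimage of \<open>d\<close> under \<open>L\<close>.\<close>
    define \<xi>' where "\<xi>' = (\<xi> - s * S / C' * t * (chg b X g + chg b Y h)) * C' / (s * C)"
    have "s * C / C' * \<xi>' + s * S / C' * t * (chg b X g + chg b Y h) = \<xi>"
      using pos by (simp add: \<xi>'_def)
    then have "L (polar_diff b r \<theta> (\<xi>', X + Y)) = d" unfolding L[OF XY] d by simp
    with that have "chg w d d = 0" by metis
    then show "d = 0" using chg_pos[OF zw(2), of d] by fastforce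
  qed
  have w: "radial_map b t \<phi> z = w"
    unfolding z_def w_def r'_def s by (rule radial_map_polar[OF b r \<theta>])
  have inv: "inv (metric_adj z w L) \<nu> = c"
    by (rule inv_metric_adj[OF zw(1) diff(1)]) (fact nondeg adj)+
  have "J_Pi b z \<nu> t \<phi> = sqrt ((metric_det z w L)\<^sup>2 * chg w c c)"
    unfolding J_Pi_def Let_def w L_def[symmetric] metric_cof_def
      inv chg_scaleR ..
  also have "(metric_det z w L)\<^sup>2 = (s ^ (2 * CARD('m)))\<^sup>2"
    using diff(3) unfolding w_def .
  also have "chg w c c = (\<alpha> * C' / (s * C)) * (\<alpha> * C' / (s * C)) + (s * S)\<^sup>2 * chg b c\<^sub>X c\<^sub>X
      + (s * S)\<^sup>2 * C'\<^sup>2 * chg b c\<^sub>Y c\<^sub>Y"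
    unfolding c_def by (rule met'[OF cXY(1) cXY(1) cXY(2) cXY(2)])
  also have "chg b c\<^sub>X c\<^sub>X = (chg b X\<^sub>v X\<^sub>v - 2 * k * \<phi>' X\<^sub>v + k\<^sup>2 * chg b g g) / s ^ 4"
  proof -
    have "\<phi>' X\<^sub>v = chg b X\<^sub>v g"
      using \<phi>'XY[OF X\<^sub>v, of 0] by (simp add: chg_simps vert_space_def span_zero)
    then show ?thesis using pos(1) unfolding c\<^sub>X_def chg_simps chg_commute[of b g X\<^sub>v]
      by (simp add: field_simps power2_eq_square power4_eq_xxxx)
  qed
  also have "chg b c\<^sub>Y c\<^sub>Y = (C ^ 4 * chg b Y\<^sub>w Y\<^sub>w - 2 * k * C\<^sup>2 * \<phi>' Y\<^sub>w + k\<^sup>2 * chg b h h) / (s ^ 4 * C' ^ 4)"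
  proof -
    have "0 \<in> hor_space b \<theta>" by (simp add: hor_space_iff chg_simps)
    from \<phi>'XY[OF this Y\<^sub>w] have "\<phi>' Y\<^sub>w = chg b Y\<^sub>w h" by (simp add: chg_simps)
    then show ?thesis using pos unfolding c\<^sub>Y_def chg_simps chg_commute[of b h Y\<^sub>w]
      by (simp add: field_simps power2_eq_square power4_eq_xxxx)
  qed
  also have "s ^ (2 * CARD('m)) = s * s ^ (2 * CARD('m) - 1)"
    by (simp flip: power_Suc)
  also have "(s * s ^ (2 * CARD('m) - 1))\<^sup>2 *
      ((\<alpha> * C' / (s * C)) * (\<alpha> * C' / (s * C))
       + (s * S)\<^sup>2 * ((chg b X\<^sub>v X\<^sub>v - 2 * k * \<phi>' X\<^sub>v + k\<^sup>2 * chg b g g) / s ^ 4)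
       + (s * S)\<^sup>2 * C'\<^sup>2 * ((C ^ 4 * chg b Y\<^sub>w Y\<^sub>w - 2 * k * C\<^sup>2 * \<phi>' Y\<^sub>w + k\<^sup>2 * chg b h h) / (s ^ 4 * C' ^ 4)))
     = (s ^ (2 * CARD('m) - 1))\<^sup>2 *
    (\<alpha>\<^sup>2 * C'\<^sup>2 / C\<^sup>2
     + (S\<^sup>2 * chg b X\<^sub>v X\<^sub>v - 2 * \<alpha> * t * (S / C) * \<phi>' X\<^sub>v + \<alpha>\<^sup>2 * t\<^sup>2 * chg b g g / C\<^sup>2)
     + (S\<^sup>2 * C ^ 4 * chg b Y\<^sub>w Y\<^sub>w - 2 * \<alpha> * t * (S * C) * \<phi>' Y\<^sub>w + \<alpha>\<^sup>2 * t\<^sup>2 * chg b h h / C\<^sup>2) / C'\<^sup>2)"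
    (is "?l = ?r")
  proof -
    have 1: "s\<^sup>2 * ((\<alpha> * C' / (s * C)) * (\<alpha> * C' / (s * C))) = \<alpha>\<^sup>2 * C'\<^sup>2 / C\<^sup>2"
      using pos by (simp add: field_simps power2_eq_square)
    have 2: "s\<^sup>2 * ((s * S)\<^sup>2 * ((p - 2 * k * q + k\<^sup>2 * u) / s ^ 4)) =
        S\<^sup>2 * p - 2 * \<alpha> * t * (S / C) * q + \<alpha>\<^sup>2 * t\<^sup>2 * u / C\<^sup>2" for p q u
      using pos unfolding k_def by (simp add: field_simps power2_eq_square power4_eq_xxxx)
    have 3: "s\<^sup>2 * ((s * S)\<^sup>2 * C'\<^sup>2 * ((C ^ 4 * p - 2 * k * C\<^sup>2 * q + k\<^sup>2 * u) / (s ^ 4 * C' ^ 4))) =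
        (S\<^sup>2 * C ^ 4 * p - 2 * \<alpha> * t * (S * C) * q + \<alpha>\<^sup>2 * t\<^sup>2 * u / C\<^sup>2) / C'\<^sup>2" for p q u
      using pos unfolding k_def by (simp add: field_simps power2_eq_square power4_eq_xxxx)
    show ?thesis unfolding 1[symmetric] 2[symmetric] 3[symmetric]
      by (simp only: power_mult_distrib[of s] distrib_left mult_ac)
  qed
  finally show ?thesis unfolding z_def C'2 S_def C_def .
qed

section \<open>Derivatives in the time parameter\<close>

lemma deriv_sqrt:
  fixes Q :: "real \<Rightarrow> real"
  assumes Q: "\<And>t. (Q has_real_derivative Q' t) (at t)" and Q': "(Q' has_real_derivative Q'') (at 0)"
    and Q0: "Q 0 = 1"
  shows "deriv (\<lambda>t. sqrt (Q t)) 0 = Q' 0 / 2"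
    and "deriv (deriv (\<lambda>t. sqrt (Q t))) 0 = Q'' / 2 - (Q' 0)\<^sup>2 / 4"
proof -
  have 1: "((\<lambda>t. sqrt (Q t)) has_real_derivative Q' t / (2 * sqrt (Q t))) (at t)" if "Q t > 0" for t :: real
    by (rule DERIV_cong[OF DERIV_chain2[where g = Q and x = t, OF DERIV_real_sqrt[OF that] Q]]) (simp add: field_simps)
  from DERIV_imp_deriv[OF 1[of 0]] show "deriv (\<lambda>t. sqrt (Q t)) 0 = Q' 0 / 2" by (simp add: Q0)
  have "isCont Q 0" by (rule DERIV_isCont[OF Q])
  then have "\<forall>\<^sub>F t in nhds 0. Q t > 0"
    using Q0 order_tendstoD(1)[of Q 1 "nhds 0" 0] by (simp add: continuous_at tendsto_nhds_iff)
  then have ev: "\<forall>\<^sub>F t in nhds 0. deriv (\<lambda>t. sqrt (Q t)) t = Q' t / (2 * sqrt (Q t))"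
    by eventually_elim (rule DERIV_imp_deriv[OF 1])
  have "((\<lambda>t. Q' t / (2 * sqrt (Q t))) has_real_derivative Q'' / 2 - (Q' 0)\<^sup>2 / 4) (at 0)"
    using DERIV_divide[OF Q' DERIV_cmult[OF 1[of 0], of 2]] Q0
    by (simp add: power2_eq_square diff_divide_distrib)
  then show "deriv (deriv (\<lambda>t. sqrt (Q t))) 0 = Q'' / 2 - (Q' 0)\<^sup>2 / 4"
    unfolding deriv_cong_ev[OF ev refl] by (rule DERIV_imp_deriv)
qed

text \<open>
  The radicand is the shape of \<open>J\<^sup>2\<close> as a function of \<open>t\<close>, with \<open>f = \<phi>(\<theta>)\<close>: the factor \<open>s\<^sup>2\<^sup>k\<close> with \<open>k = n - 1\<close>, and the
  radial, horizontal and vertical contributions. The hypothesis on the value at 0 is \<open>|\<nu>| = 1\<close>, and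
  \<open>p\<close> is the derivative at 0 of the parenthesis.
\<close>

lemma deriv_jacobian_profile:
  fixes Q :: "real \<Rightarrow> real" and k :: nat and f a b\<^sub>0 b\<^sub>1 b\<^sub>2 c\<^sub>0 c\<^sub>1 c\<^sub>2 x p :: real
  assumes Q: "\<And>t. Q t = (exp (t * f) ^ k)\<^sup>2 *
     (a * (1 + (exp (t * f))\<^sup>2 * x) + (b\<^sub>0 + b\<^sub>1 * t + b\<^sub>2 * t\<^sup>2)
      + (c\<^sub>0 + c\<^sub>1 * t + c\<^sub>2 * t\<^sup>2) / (1 + (exp (t * f))\<^sup>2 * x))"
    and x: "x \<ge> 0" and Q0: "a * (1 + x) + b\<^sub>0 + c\<^sub>0 / (1 + x) = 1"
    and p: "p = 2 * f * x * a + b\<^sub>1 + c\<^sub>1 / (1 + x) - 2 * f * x * c\<^sub>0 / (1 + x)\<^sup>2"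
  shows "deriv (\<lambda>t. sqrt (Q t)) 0 = k * f + p / 2"
    and "deriv (deriv (\<lambda>t. sqrt (Q t))) 0 = k\<^sup>2 * f\<^sup>2 + k * f * p - p\<^sup>2 / 4 +
      (2 * f\<^sup>2 * x * a + b\<^sub>2 + c\<^sub>2 / (1 + x) - 2 * f * x * c\<^sub>1 / (1 + x)\<^sup>2
        + c\<^sub>0 * (4 * f\<^sup>2 * x\<^sup>2 / (1 + x) ^ 3 - 2 * f\<^sup>2 * x / (1 + x)\<^sup>2))"
proof -
  define E where "E t = exp (2 * f * t)" for t :: real
  define U where "U t = 1 + E t * x" for t :: real
  define M where "M t = c\<^sub>0 + c\<^sub>1 * t + c\<^sub>2 * t\<^sup>2" for t :: real
  define P where "P t = a * U t + (b\<^sub>0 + b\<^sub>1 * t + b\<^sub>2 * t\<^sup>2) + M t / U t" for t :: real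
  define P' where "P' t = a * (2 * f * E t * x) + (b\<^sub>1 + 2 * b\<^sub>2 * t)
      + ((c\<^sub>1 + 2 * c\<^sub>2 * t) / U t - M t * (2 * f * E t * x) / (U t)\<^sup>2)" for t :: real
  define K where "K t = exp (2 * k * f * t)" for t :: real
  have QK: "Q = (\<lambda>t. K t * P t)"
  proof
    fix t
    have "(exp (t * f))\<^sup>2 = E t" "(exp (t * f) ^ k)\<^sup>2 = K t"
      by (simp_all add: E_def K_def mult_ac flip: exp_of_nat_mult power_mult)
    then show "Q t = K t * P t" unfolding Q P_def M_def U_def by simp
  qed
  have U: "U t > 0" for t using x by (simp add: U_def E_def add_pos_nonneg)
  have dE [derivative_intros]: "(E has_real_derivative 2 * f * E t) (at t)" for t :: real
    unfolding E_def by (auto intro!: derivative_eq_intros)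
  have dK [derivative_intros]: "(K has_real_derivative 2 * k * f * K t) (at t)" for t :: real
    unfolding K_def by (auto intro!: derivative_eq_intros)
  have dU [derivative_intros]: "(U has_real_derivative 2 * f * E t * x) (at t)" for t :: real
    unfolding U_def by (auto intro!: derivative_eq_intros)
  have dM [derivative_intros]: "(M has_real_derivative c\<^sub>1 + 2 * c\<^sub>2 * t) (at t)" for t :: real
    unfolding M_def by (auto intro!: derivative_eq_intros)
  have dP: "(P has_real_derivative P' t) (at t)" for t :: real
  proof -
    have dq: "((\<lambda>t. M t / U t) has_real_derivative
        (c\<^sub>1 + 2 * c\<^sub>2 * t) / U t - M t * (2 * f * E t * x) / (U t)\<^sup>2) (at t)"
      by (rule DERIV_cong[OF DERIV_divide[OF dM dU]])
        (use U[of t] in \<open>simp_all add: field_simps power2_eq_square\<close>)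
    have da: "((\<lambda>t. a * U t) has_real_derivative a * (2 * f * E t * x)) (at t)"
      by (rule DERIV_cmult[OF dU])
    have db: "((\<lambda>t. b\<^sub>0 + b\<^sub>1 * t + b\<^sub>2 * t\<^sup>2) has_real_derivative b\<^sub>1 + 2 * b\<^sub>2 * t) (at t)"
      by (auto intro!: derivative_eq_intros)
    show ?thesis unfolding P_def[abs_def] P'_def by (rule DERIV_add[OF DERIV_add[OF da db] dq])
  qed
  define P'' where "P'' = a * (4 * f\<^sup>2 * x) + 2 * b\<^sub>2
      + (2 * c\<^sub>2 / (1 + x) - c\<^sub>1 * (2 * f * x) / (1 + x)\<^sup>2
         - (c\<^sub>1 * (2 * f * x) + c\<^sub>0 * (4 * f\<^sup>2 * x)) / (1 + x)\<^sup>2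
         + c\<^sub>0 * (2 * f * x) * (2 * (2 * f * x)) / (1 + x) ^ 3)"
  have v0: "E 0 = 1" "U 0 = 1 + x" "M 0 = c\<^sub>0" "K 0 = 1" by (simp_all add: E_def U_def M_def K_def)
  have dP': "(P' has_real_derivative P'') (at 0)"
  proof -
    have d1: "((\<lambda>t. (c\<^sub>1 + 2 * c\<^sub>2 * t) / U t) has_real_derivative
       2 * c\<^sub>2 / (1 + x) - c\<^sub>1 * (2 * f * x) / (1 + x)\<^sup>2) (at 0)"
    proof -
      have "((\<lambda>t. c\<^sub>1 + 2 * c\<^sub>2 * t) has_real_derivative 2 * c\<^sub>2) (at 0)"
        by (auto intro!: derivative_eq_intros)
      from DERIV_divide[OF this dU] show ?thesis
        by (rule DERIV_cong) (use x in \<open>simp_all add: v0 diff_divide_distrib power2_eq_square\<close>)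
    qed
    have d2: "((\<lambda>t. M t * (2 * f * E t * x) / (U t)\<^sup>2) has_real_derivative
       (c\<^sub>1 * (2 * f * x) + c\<^sub>0 * (4 * f\<^sup>2 * x)) / (1 + x)\<^sup>2
         - c\<^sub>0 * (2 * f * x) * (2 * (2 * f * x)) / (1 + x) ^ 3) (at 0)"
    proof -
      have n: "((\<lambda>t. M t * (2 * f * E t * x)) has_real_derivative
          c\<^sub>1 * (2 * f * x) + c\<^sub>0 * (4 * f\<^sup>2 * x)) (at 0)"
        by (rule derivative_eq_intros refl)+ (simp add: v0 power2_eq_square)
      have d: "((\<lambda>t. (U t)\<^sup>2) has_real_derivative 2 * (1 + x) * (2 * f * x)) (at 0)"
        by (rule derivative_eq_intros refl)+ (simp add: v0)
      have h: "((\<lambda>t. M t * (2 * f * E t * x) / (U t)\<^sup>2) has_real_derivative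
          ((c\<^sub>1 * (2 * f * x) + c\<^sub>0 * (4 * f\<^sup>2 * x)) * (1 + x)\<^sup>2 - c\<^sub>0 * (2 * f * x) * (2 * (1 + x) * (2 * f * x)))
           / ((1 + x)\<^sup>2 * (1 + x)\<^sup>2)) (at 0)"
        using DERIV_divide[OF n d] U[of 0] by (simp add: v0)
      have key: "(A * u\<^sup>2 - B * (2 * u * D)) / (u\<^sup>2 * u\<^sup>2) = A / u\<^sup>2 - B * (2 * D) / u ^ 3" if "u > 0" for A B D u :: real
        using that by (simp add: field_simps power2_eq_square power3_eq_cube)
      show ?thesis by (rule DERIV_cong[OF h key]) (use x in simp)
    qed
    have d3: "((\<lambda>t. a * (2 * f * E t * x)) has_real_derivative a * (4 * f\<^sup>2 * x)) (at 0)"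
      by (rule derivative_eq_intros refl)+ (simp add: v0 power2_eq_square)
    have d4: "((\<lambda>t. b\<^sub>1 + 2 * b\<^sub>2 * t) has_real_derivative 2 * b\<^sub>2) (at 0)"
      by (auto intro!: derivative_eq_intros)
    show ?thesis unfolding P'_def[abs_def]
      by (rule DERIV_cong[OF DERIV_add[OF DERIV_add[OF d3 d4] DERIV_diff[OF d1 d2]]]) (simp add: P''_def)
  qed
  have P0: "P 0 = 1" "P' 0 = p" using Q0 by (simp_all add: P_def P'_def v0 p)
  have d1: "(Q has_real_derivative 2 * k * f * K t * P t + P' t * K t) (at t)" for t :: real
    unfolding QK by (rule DERIV_mult[OF dK dP])
  have d2: "((\<lambda>t. 2 * k * f * K t * P t + P' t * K t) has_real_derivative
      4 * k\<^sup>2 * f\<^sup>2 + 4 * k * f * p + P'') (at 0)"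
    by (rule derivative_eq_intros dP dP' refl)+ (simp add: v0 P0 algebra_simps power2_eq_square)
  have "Q 0 = 1" by (simp add: QK v0 P0)
  note deriv_sqrt[OF d1 d2 this]
  then have 1: "deriv (\<lambda>t. sqrt (Q t)) 0 = (2 * k * f + p) / 2"
    "deriv (deriv (\<lambda>t. sqrt (Q t))) 0 = (4 * k\<^sup>2 * f\<^sup>2 + 4 * k * f * p + P'') / 2 - (2 * k * f + p)\<^sup>2 / 4"
    by (simp_all add: v0 P0)
  show "deriv (\<lambda>t. sqrt (Q t)) 0 = k * f + p / 2" using 1(1) by simp
  define T where "T = 2 * f\<^sup>2 * x * a + b\<^sub>2 + c\<^sub>2 / (1 + x) - 2 * f * x * c\<^sub>1 / (1 + x)\<^sup>2
        + c\<^sub>0 * (4 * f\<^sup>2 * x\<^sup>2 / (1 + x) ^ 3 - 2 * f\<^sup>2 * x / (1 + x)\<^sup>2)"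
  have T: "P'' = 2 * T"
    unfolding P''_def T_def by (simp add: algebra_simps add_divide_distrib power2_eq_square)
  show "deriv (deriv (\<lambda>t. sqrt (Q t))) 0 = k\<^sup>2 * f\<^sup>2 + k * f * p - p\<^sup>2 / 4 +
      (2 * f\<^sup>2 * x * a + b\<^sub>2 + c\<^sub>2 / (1 + x) - 2 * f * x * c\<^sub>1 / (1 + x)\<^sup>2
        + c\<^sub>0 * (4 * f\<^sup>2 * x\<^sup>2 / (1 + x) ^ 3 - 2 * f\<^sup>2 * x / (1 + x)\<^sup>2))"
    unfolding 1(2) T T_def[symmetric] by (simp add: power2_eq_square algebra_simps add_divide_distrib)
qed

section \<open>The trace\<close>

text \<open>
  The map that sends coefficients to linear combinations of the \<open>e j\<close> is injective by orthonormality,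
  hence surjective by dimension, so every vector is expanded in the \<open>e j\<close>.
\<close>

lemma parseval:
  fixes e :: "'m + 'm \<Rightarrow> complex ^ 'm"
  assumes e: "\<And>i j. chg b (e i) (e j) = (if i = j then 1 else 0)"
  shows "(\<Sum>j\<in>UNIV. chg b u (e j) * chg b v (e j)) = chg b u v"
proof -
  define T where "T a = (\<Sum>j\<in>UNIV. (a $ j) *\<^sub>R e j)" for a :: "real ^ ('m + 'm)"
  note sums = bounded_bilinear.sum_left[OF bilinear_chg] bounded_bilinear.sum_right[OF bilinear_chg]
  have lin: "linear T" by (simp add: linear_iff T_def scaleR_add_left sum.distrib scaleR_sum_right)
  have coeff: "chg b (T a) (e j) = a $ j" for a j
    by (simp add: T_def sums chg_simps e if_distrib cong: if_cong)
  have "inj T" by (rule injI) (metis coeff vec_eq_iff)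
  have "dim (UNIV :: (complex ^ 'm) set) = dim (UNIV :: (real ^ ('m + 'm)) set)"
    by simp
  from linear_injective_imp_surjective[OF lin \<open>inj T\<close> this]
  obtain a where a: "v = T a" by (metis surjD)
  have "chg b u v = (\<Sum>j\<in>UNIV. chg b u (e j) * a $ j)"
    unfolding a by (simp add: T_def sums chg_simps mult.commute)
  then show ?thesis by (simp add: a coeff)
qed

theorem theorem2p7:
  fixes b z \<theta> \<nu> v w :: "complex ^ 'm"
    and e :: "'m + 'm \<Rightarrow> complex ^ 'm"
    and n :: nat
    and r \<alpha> \<beta> \<gamma> x :: real
  assumes n: "n = 2 * CARD('m)" "n \<ge> 4"
    and b: "b \<in> CH"
    and e: "\<And>i j. chg b (e i) (e j) = (if i = j then 1 else 0)"
    and z: "z \<in> CH - {b}" "polar_coords b z = (r, \<theta>)"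
    and \<nu>: "chg z \<nu> \<nu> = 1" "\<nu> = \<alpha> *\<^sub>R polar_diff b r \<theta> (1, 0) + v + w"
    and v: "v \<in> polar_diff b r \<theta> ` ({0} \<times> hor_space b \<theta>)"
    and w: "w \<in> polar_diff b r \<theta> ` ({0} \<times> vert_space \<theta>)"
    and \<beta>: "\<beta> = chg z v v"
    and \<gamma>: "\<gamma> = chg z w w"
    and x: "x = (sinh r)\<^sup>2"
  shows "trace_form b e z \<nu> =
    - ((x\<^sup>2 - x - 1) * \<beta>\<^sup>2 + (4 * x\<^sup>2 - x - 2) * \<beta> * \<gamma> + (4 * x\<^sup>2 - 1) * \<gamma>\<^sup>2
        + ((real n - 2) * x\<^sup>2 + (2 * real n - 1) * x + real n) * \<beta>
        + ((2 * real n - 8) * x\<^sup>2 + (3 * real n - 2) * x + real n) * \<gamma>)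
      / (1 + x)\<^sup>2"
proof -
  have r: "0 < r" and \<theta>: "\<theta> \<in> unit_sphere b" and zr: "z = polar b r \<theta>"
    using polar_coordsE[OF b z] by auto
  obtain X\<^sub>v where X\<^sub>v: "X\<^sub>v \<in> hor_space b \<theta>" "v = polar_diff b r \<theta> (0, X\<^sub>v)" using v by auto
  obtain Y\<^sub>w where Y\<^sub>w: "Y\<^sub>w \<in> vert_space \<theta>" "w = polar_diff b r \<theta> (0, Y\<^sub>w)" using w by auto
  define S where "S = sinh r"
  define C where "C = cosh r"
  have pos: "S > 0" "C > 0" using r by (simp_all add: S_def C_def cosh_real_pos)
  have xS: "x = S\<^sup>2" by (simp add: x S_def)
  have C2: "C\<^sup>2 = 1 + x" using cosh_square_eq[of r] by (simp add: xS C_def S_def)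
  have xpos: "x > 0" using pos by (simp add: xS)
  have th: "chg b \<theta> \<theta> = 1" using \<theta> by (simp add: unit_sphere_def)
  have zero: "0 \<in> hor_space b \<theta>" "0 \<in> vert_space \<theta>"
    by (simp_all add: hor_space_iff chg_simps vert_space_def span_zero)
  note met = polar_metric[OF b \<theta> r, folded zr, folded S_def C_def]
  have \<beta>X: "\<beta> = S\<^sup>2 * chg b X\<^sub>v X\<^sub>v"
    using met[OF X\<^sub>v(1) X\<^sub>v(1) zero(2) zero(2), of 0 0] by (simp add: \<beta> X\<^sub>v(2) chg_simps)
  have \<gamma>Y: "\<gamma> = S\<^sup>2 * C\<^sup>2 * chg b Y\<^sub>w Y\<^sub>w"
    using met[OF zero(1) zero(1) Y\<^sub>w(1) Y\<^sub>w(1), of 0 0] by (simp add: \<gamma> Y\<^sub>w(2) chg_simps)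
  have \<nu>P: "\<nu> = polar_diff b r \<theta> (\<alpha>, X\<^sub>v + Y\<^sub>w)"
  proof -
    note lin = polar_diff_linear[OF b \<theta>, of r]
    show ?thesis unfolding \<nu>(2) X\<^sub>v(2) Y\<^sub>w(2)
      by (simp flip: linear_add[OF lin] linear_scale[OF lin])
  qed
  have \<alpha>2: "\<alpha>\<^sup>2 = 1 - \<beta> - \<gamma>"
    using \<nu>(1) unfolding \<nu>P met[OF X\<^sub>v(1) X\<^sub>v(1) Y\<^sub>w(1) Y\<^sub>w(1)] \<beta>X \<gamma>Y by (simp add: power2_eq_square)
  define k where "k = n - 1"
  have k: "real k = real n - 1" using n(2) by (simp add: k_def of_nat_diff)
  have jac: "J_Pi b z \<nu> t \<phi> = sqrt ((exp (t * \<phi> \<theta>) ^ k)\<^sup>2 *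
     (\<alpha>\<^sup>2 / (1 + x) * (1 + (exp (t * \<phi> \<theta>))\<^sup>2 * x)
      + (\<beta> + (- 2 * \<alpha> * (S / C) * \<phi>' X\<^sub>v) * t + (\<alpha>\<^sup>2 * chg b g g / (1 + x)) * t\<^sup>2)
      + ((1 + x) * \<gamma> + (- 2 * \<alpha> * (S * C) * \<phi>' Y\<^sub>w) * t + (\<alpha>\<^sup>2 * chg b h h / (1 + x)) * t\<^sup>2)
         / (1 + (exp (t * \<phi> \<theta>))\<^sup>2 * x)))"
    if "(\<phi> has_derivative \<phi>') (at \<theta>)" "g \<in> hor_space b \<theta>" "h \<in> vert_space \<theta>"
      "\<And>X. chg b X \<theta> = 0 \<Longrightarrow> \<phi>' X = chg b X (g + h)" for t \<phi> \<phi>' g h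
  proof -
    have "C ^ 4 = C\<^sup>2 * C\<^sup>2" by (simp add: power4_eq_xxxx power2_eq_square)
    then show ?thesis
      using J_Pi_formula[OF b \<theta> r that(1) \<nu>P X\<^sub>v(1) Y\<^sub>w(1) that(2-4) refl, of t]
      unfolding zr[symmetric] S_def[symmetric] C_def[symmetric] xS[symmetric] C2 n(1)[symmetric] k_def[symmetric]
      by (simp add: \<beta>X \<gamma>Y C2 xS[symmetric] mult_ac)
  qed
  have one: "\<alpha>\<^sup>2 / (1 + x) * (1 + x) + \<beta> + (1 + x) * \<gamma> / (1 + x) = 1"
    using xpos by (simp add: \<alpha>2)
  \<comment> \<open>\<open>2 f x a + m (A + D)\<close> is the derivative at 0 of \<open>J\<^sup>2 / s\<^sup>2\<^sup>k\<close> when \<open>f\<close>, \<open>A\<close>, \<open>D\<close> are the value of \<open>\<phi>\<close> and its derivatives along \<open>X\<^sub>v\<close>, \<open>Y\<^sub>w\<close>.\<close>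
  define a where "a = (\<alpha>\<^sup>2 - \<gamma>) / (1 + x)"
  define m where "m = - 2 * \<alpha> * (S / C)"
  have m2: "m\<^sup>2 = 4 * \<alpha>\<^sup>2 * x / (1 + x)" by (simp add: m_def power_mult_distrib power_divide xS C2)
  have SC: "- 2 * \<alpha> * (S * C) * D / (1 + x) = m * D" for D
    using pos by (simp add: m_def C2[symmetric] power2_eq_square)
  have pform: "2 * f * x * (\<alpha>\<^sup>2 / (1 + x)) + m * A + - 2 * \<alpha> * (S * C) * D / (1 + x) - 2 * f * x * ((1 + x) * \<gamma>) / (1 + x)\<^sup>2
      = 2 * f * x * a + m * (A + D)" for f A D
  proof -
    have "2 * f * x * ((1 + x) * \<gamma>) / (1 + x)\<^sup>2 = 2 * f * x * (\<gamma> / (1 + x))"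
      using xpos by (simp add: power2_eq_square)
    then show ?thesis unfolding SC a_def by (simp add: algebra_simps diff_divide_distrib)
  qed
  have unit: "deriv (\<lambda>t. J_Pi b z \<nu> t (\<lambda>_. 1)) 0 = k + x * a"
  proof -
    have J: "J_Pi b z \<nu> t (\<lambda>_. 1) = sqrt ((exp (t * 1) ^ k)\<^sup>2 *
     (\<alpha>\<^sup>2 / (1 + x) * (1 + (exp (t * 1))\<^sup>2 * x) + (\<beta> + 0 * t + 0 * t\<^sup>2)
      + ((1 + x) * \<gamma> + 0 * t + 0 * t\<^sup>2) / (1 + (exp (t * 1))\<^sup>2 * x)))" for t
      using jac[OF has_derivative_const zero, of t 1] by (simp add: chg_simps)
    show ?thesis
      unfolding J by (subst deriv_jacobian_profile(1)[OF refl less_imp_le[OF xpos] one refl])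
        (use pform[of 1 0 0] in simp)
  qed
  define \<mu> where "\<mu> = m\<^sup>2 / 4"
  define c\<^sub>1 where "c\<^sub>1 = k\<^sup>2 + 2 * k * x * a - x\<^sup>2 * a\<^sup>2 + 2 * x * \<alpha>\<^sup>2 / (1 + x) - \<alpha>\<^sup>2 / (1 + x)
      + \<gamma> * (4 * x\<^sup>2 / (1 + x)\<^sup>2 - 2 * x / (1 + x))"
  define c\<^sub>2 where "c\<^sub>2 = k * m - x * a * m"
  define c\<^sub>3 where "c\<^sub>3 = c\<^sub>2 - 2 * x * m / (1 + x)"
  \<comment> \<open>Every term is a constant or a product of two inner products with \<open>e j\<close>, ready for the sum over \<open>j\<close>.\<close>
  have second: "deriv (deriv (\<lambda>t. J_Pi b z \<nu> t (\<lambda>\<theta>. chg b \<theta> (e j)))) 0 =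
      c\<^sub>1 * (chg b \<theta> (e j) * chg b \<theta> (e j))
      + c\<^sub>2 * (chg b \<theta> (e j) * chg b X\<^sub>v (e j)) + c\<^sub>3 * (chg b \<theta> (e j) * chg b Y\<^sub>w (e j))
      - \<mu> * (chg b X\<^sub>v (e j) * chg b X\<^sub>v (e j) + 2 * (chg b X\<^sub>v (e j) * chg b Y\<^sub>w (e j)) + chg b Y\<^sub>w (e j) * chg b Y\<^sub>w (e j))
      + \<alpha>\<^sup>2 / (1 + x) + (\<alpha>\<^sup>2 / (1 + x)\<^sup>2 - \<alpha>\<^sup>2 / (1 + x)) * (chg b (\<i> *s \<theta>) (e j) * chg b (\<i> *s \<theta>) (e j))" for j
  proof -
    define f where "f = chg b \<theta> (e j)"
    define A where "A = chg b X\<^sub>v (e j)"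
    define D where "D = chg b Y\<^sub>w (e j)"
    define i where "i = chg b (\<i> *s \<theta>) (e j)"
    \<comment> \<open>The part \<open>u = g + h\<close> of \<open>e j\<close> tangent to the sphere is the gradient of \<open>\<langle>\<cdot>, e j\<rangle>\<close> at \<open>\<theta>\<close>.\<close>
    define u where "u = e j - f *\<^sub>R \<theta>"
    have u0: "chg b u \<theta> = 0"
      by (simp add: u_def chg_simps th f_def chg_commute[of b "e j"])
    obtain g h where gh: "g \<in> hor_space b \<theta>" "h \<in> vert_space \<theta>" "u = g + h"
      and h: "h = chg b u (\<i> *s \<theta>) *\<^sub>R (\<i> *s \<theta>)"
      by (rule tangent_decomposition[OF \<theta> u0])
    have "chg b u (\<i> *s \<theta>) = i"
      by (simp add: u_def chg_simps i_def chg_commute[of b "e j"] chg_commute[of b \<theta>] chg_i_self)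
    then have hh: "chg b h h = i\<^sup>2" unfolding h by (simp add: chg_simps chg_times_i th power2_eq_square)
    have "chg b u u = 1 - f\<^sup>2"
      by (simp add: u_def chg_simps th e chg_commute[of b "e j" \<theta>] power2_eq_square flip: f_def)
    moreover have "chg b u u = chg b g g + chg b h h"
      using hor_vert_orthogonal[OF gh(1,2)] by (simp add: gh(3) chg_simps chg_commute[of b h g])
    ultimately have gg: "chg b g g = 1 - f\<^sup>2 - i\<^sup>2" by (simp add: hh)
    have d: "((\<lambda>\<theta>. chg b \<theta> (e j)) has_derivative (\<lambda>X. chg b X (e j))) (at \<theta>)"
      by (rule bounded_linear_imp_has_derivative[OF bounded_bilinear.bounded_linear_left[OF bilinear_chg]])
    have grad: "chg b X (e j) = chg b X (g + h)" if "chg b X \<theta> = 0" for X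
      unfolding gh(3)[symmetric] u_def by (simp add: chg_simps that)
    have J: "J_Pi b z \<nu> t (\<lambda>\<theta>. chg b \<theta> (e j)) = sqrt ((exp (t * f) ^ k)\<^sup>2 *
       (\<alpha>\<^sup>2 / (1 + x) * (1 + (exp (t * f))\<^sup>2 * x)
        + (\<beta> + m * A * t + (\<alpha>\<^sup>2 * (1 - f\<^sup>2 - i\<^sup>2) / (1 + x)) * t\<^sup>2)
        + ((1 + x) * \<gamma> + (- 2 * \<alpha> * (S * C) * D) * t + (\<alpha>\<^sup>2 * i\<^sup>2 / (1 + x)) * t\<^sup>2)
           / (1 + (exp (t * f))\<^sup>2 * x)))" for t
      by (rule jac[OF d gh(1,2), folded f_def A_def D_def, unfolded gg hh, folded m_def]) (rule grad)
    have "deriv (deriv (\<lambda>t. J_Pi b z \<nu> t (\<lambda>\<theta>. chg b \<theta> (e j)))) 0 =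
       k\<^sup>2 * f\<^sup>2 + k * f * (2 * f * x * a + m * (A + D)) - (2 * f * x * a + m * (A + D))\<^sup>2 / 4 +
      (2 * f\<^sup>2 * x * (\<alpha>\<^sup>2 / (1 + x)) + \<alpha>\<^sup>2 * (1 - f\<^sup>2 - i\<^sup>2) / (1 + x) + \<alpha>\<^sup>2 * i\<^sup>2 / (1 + x) / (1 + x)
        - 2 * f * x * (- 2 * \<alpha> * (S * C) * D) / (1 + x)\<^sup>2
        + (1 + x) * \<gamma> * (4 * f\<^sup>2 * x\<^sup>2 / (1 + x) ^ 3 - 2 * f\<^sup>2 * x / (1 + x)\<^sup>2))"
      unfolding J by (rule deriv_jacobian_profile(2)[OF refl less_imp_le[OF xpos] one pform[symmetric]])
    also have "2 * f * x * (- 2 * \<alpha> * (S * C) * D) / (1 + x)\<^sup>2 = 2 * f * x * (m * D) / (1 + x)"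
      unfolding SC[symmetric] by (simp add: power2_eq_square)
    also have "(1 + x) * \<gamma> * (4 * f\<^sup>2 * x\<^sup>2 / (1 + x) ^ 3 - 2 * f\<^sup>2 * x / (1 + x)\<^sup>2)
       = \<gamma> * (4 * x\<^sup>2 / (1 + x)\<^sup>2 - 2 * x / (1 + x)) * f\<^sup>2"
    proof -
      have "y * \<gamma> * (4 * f\<^sup>2 * x\<^sup>2 / y ^ 3 - 2 * f\<^sup>2 * x / y\<^sup>2)
          = \<gamma> * (4 * x\<^sup>2 / y\<^sup>2 - 2 * x / y) * f\<^sup>2" if "y > 0" for y :: real
        using that by (simp add: field_simps power2_eq_square power3_eq_cube)
      then show ?thesis using xpos by simp
    qed
    finally show ?thesis
      unfolding f_def[symmetric] A_def[symmetric] D_def[symmetric] i_def[symmetric] \<mu>_def c\<^sub>1_def c\<^sub>3_def c\<^sub>2_def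
      by (simp add: algebra_simps power2_eq_square add_divide_distrib diff_divide_distrib)
  qed
  note P = parseval[OF e]
  have orth: "chg b \<theta> X\<^sub>v = 0" "chg b \<theta> Y\<^sub>w = 0" "chg b X\<^sub>v Y\<^sub>w = 0"
    using X\<^sub>v(1) Y\<^sub>w(1) hor_vert_orthogonal[OF X\<^sub>v(1) Y\<^sub>w(1)]
    by (simp_all add: hor_space_iff vert_tangent chg_commute[of b \<theta>])
  have X2: "\<mu> * chg b X\<^sub>v X\<^sub>v = \<alpha>\<^sup>2 * \<beta> / (1 + x)" "\<mu> * chg b Y\<^sub>w Y\<^sub>w = \<alpha>\<^sup>2 * \<gamma> / (1 + x)\<^sup>2"
  proof -
    have "\<beta> = x * chg b X\<^sub>v X\<^sub>v" "\<gamma> = x * (1 + x) * chg b Y\<^sub>w Y\<^sub>w"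
      by (simp_all only: \<beta>X \<gamma>Y xS C2)
    note BG = this
    have \<mu>: "\<mu> = \<alpha>\<^sup>2 * x / (1 + x)" unfolding \<mu>_def m2 using xpos by (simp add: field_simps)
    show "\<mu> * chg b X\<^sub>v X\<^sub>v = \<alpha>\<^sup>2 * \<beta> / (1 + x)" "\<mu> * chg b Y\<^sub>w Y\<^sub>w = \<alpha>\<^sup>2 * \<gamma> / (1 + x)\<^sup>2"
      unfolding \<mu> BG using xpos by (simp_all add: power2_eq_square)
  qed
  have "trace_form b e z \<nu> = c\<^sub>1 - (\<mu> * chg b X\<^sub>v X\<^sub>v + \<mu> * chg b Y\<^sub>w Y\<^sub>w)
      + n * (\<alpha>\<^sup>2 / (1 + x)) + (\<alpha>\<^sup>2 / (1 + x)\<^sup>2 - \<alpha>\<^sup>2 / (1 + x)) - n * (k + x * a)"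
    unfolding trace_form_def second unit
    by (simp add: sum.distrib sum_subtractf P orth th chg_times_i n(1) distrib_left flip: sum_distrib_left)
  also have "\<dots> = c\<^sub>1 - (\<alpha>\<^sup>2 * \<beta> / (1 + x) + \<alpha>\<^sup>2 * \<gamma> / (1 + x)\<^sup>2)
      + n * (\<alpha>\<^sup>2 / (1 + x)) + (\<alpha>\<^sup>2 / (1 + x)\<^sup>2 - \<alpha>\<^sup>2 / (1 + x)) - n * (k + x * a)"
    unfolding X2 ..
  also have "\<dots> = - ((x\<^sup>2 - x - 1) * \<beta>\<^sup>2 + (4 * x\<^sup>2 - x - 2) * \<beta> * \<gamma> + (4 * x\<^sup>2 - 1) * \<gamma>\<^sup>2
        + ((real n - 2) * x\<^sup>2 + (2 * real n - 1) * x + real n) * \<beta>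
        + ((2 * real n - 8) * x\<^sup>2 + (3 * real n - 2) * x + real n) * \<gamma>)
      / (1 + x)\<^sup>2"
  proof -
    have "1 + x \<noteq> 0" using xpos by simp
    moreover have "real n = real k + 1" using k by simp
    ultimately show ?thesis unfolding c\<^sub>1_def a_def \<alpha>2 of_nat_power
      by (simp add: divide_simps) (simp add: algebra_simps power2_eq_square)
  qed
  finally show ?thesis .
qed

end
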